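(* Let $p\ge 1$ be an integer, let $a_1,\ldots,a_{p+1},b_1,\ldots,b_p$ be complex numbers with no $a_j$ equal to a nonpositive integer, and put $s_p=b_1+\cdots+b_p-a_1-a_2-\cdots-a_{p+1}$. Suppose $\Re(a_j)>0$ for $j=3,\ldots,p+1$, and let $$g_0(0)=\frac{\Gamma(a_1)\Gamma(a_2)\Gamma(s_p)}{\Gamma(a_1+s_p)\Gamma(a_2+s_p)}\sum_{k=0}^\infty\frac{(s_p)_k}{(a_1+s_p)_k(a_2+s_p)_k}A_k^{(p)}.$$ If $s_p$ is not equal to an integer and $N\in\{0,1,2,\ldots\}$ is chosen to be greater than $\Re(-s_p)$, then $$\sum_{l=0}^{m-1}\frac{\Gamma(a_1+l)\Gamma(a_2+l)\cdots\Gamma(a_{p+1}+l)}{\Gamma(b_1+l)\cdots\Gamma(b_p+l)\Gamma(1+l)}=g_0(0)-\sum_{n=0}^{N}(-1)^n\frac{1}{s_p+n}\,\frac{(a_1+s_p)_n(a_2+s_p)_n}{(1)_n}\,\frac{\Gamma(-s_p-n+m)}{\Gamma(m)}\sum_{k=0}^{n}\frac{(-n)_k}{(a_1+s_p)_k(a_2+s_p)_k}A_k^{(p)}+O(m^{-s_p-N-1})$$ as $m\to\infty$ through the positive integers.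
   Context: $(x)_n=x(x+1)\cdots(x+n-1)=\Gamma(x+n)/\Gamma(x)$ is the Pochhammer symbol, $(x)_0=1$. The coefficients $A_k^{(p)}=A_k^{(p)}(a_3,\ldots,a_{p+1};b_1,\ldots,b_p)$, $k=0,1,2,\ldots$, are defined recursively in $p$: $A_0^{(1)}=1$ and $A_k^{(1)}=0$ for $k>0$; for $p\ge2$, $$A_k^{(p)}(a_3,\ldots,a_{p+1};b_1,\ldots,b_p)=\sum_{j=0}^{k}\frac{\bigl(\sum_{i=2}^{p}b_i-\sum_{i=3}^{p+1}a_i+j\bigr)_{k-j}\,(b_1-a_3)_{k-j}}{(k-j)!}\,A_j^{(p-1)}(a_4,\ldots,a_{p+1};b_2,\ldots,b_p).$$ For example $A_k^{(2)}=(b_2-a_3)_k(b_1-a_3)_k/k!$ and $A_k^{(3)}=\sum_{j=0}^k\frac{(b_3+b_2-a_4-a_3+j)_{k-j}(b_1-a_3)_{k-j}(b_3-a_4)_j(b_2-a_4)_j}{(k-j)!\,j!}$. The infinite series defining $g_0(0)$ converges when $\Re(a_j)>0$ for $j=3,\ldots,p+1$. The parameters and $N$ are fixed and $m\to\infty$; for complex $s$, $O(m^{-s})$ means bounded in absolute value by a constant times $m^{-\Re(s)}$. $1/\Gamma$ is regarded as an entire function (zero at nonpositive integers), $\frac{1}{\Gamma(x)(x)_k}$ is read as $1/\Gamma(x+k)$, and for $k\le n$ the quotient $(x)_n/(x)_k$ is read as $(x+k)_{n-k}$. *)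

theory Defs
  imports "HOL-Analysis.Gamma_Function" "HOL-Library.Landau_Symbols"
begin

text \<open>
  Parameter families are functions on \<open>nat\<close> read at the indices \<open>1, 2, \<dots>\<close>; other values are
  irrelevant. \<open>coeff_A p a b k\<close> is $A_k^{(p)}(a_3,\ldots,a_{p+1};b_1,\ldots,b_p)$, so it reads \<open>a\<close>
  only on \<open>{3..p+1}\<close> and \<open>b\<close> only on \<open>{1..p}\<close>. Shifting both families by one turns the slots
  $3,\ldots,p$ and $1,\ldots,p-1$ of the recursive call into $a_4,\ldots,a_{p+1}$ and
  $b_2,\ldots,b_p$. The case \<open>p = 0\<close> is deliberately left unspecified.
\<close>

fun coeff_A :: "nat \<Rightarrow> (nat \<Rightarrow> complex) \<Rightarrow> (nat \<Rightarrow> complex) \<Rightarrow> nat \<Rightarrow> complex" where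
  "coeff_A (Suc 0) a b k = (if k = 0 then 1 else 0)"
| "coeff_A (Suc (Suc q)) a b k =
    (let p = Suc (Suc q) in
     \<Sum>j=0..k. pochhammer ((\<Sum>i=2..p. b i) - (\<Sum>i=3..p+1. a i) + of_nat j) (k - j)
              * pochhammer (b 1 - a 3) (k - j) / fact (k - j)
              * coeff_A (Suc q) (\<lambda>i. a (i + 1)) (\<lambda>i. b (i + 1)) j)"

definition param_s :: "nat \<Rightarrow> (nat \<Rightarrow> complex) \<Rightarrow> (nat \<Rightarrow> complex) \<Rightarrow> complex" where
  "param_s p a b = (\<Sum>i=1..p. b i) - (\<Sum>i=1..p+1. a i)"

text \<open>
  The quotient $1/(\Gamma(a_i+s)\,(a_i+s)_k)$ is read as the entire function $1/\Gamma(a_i+s+k)$,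
  which is why the two reciprocal Gamma factors sit inside the series.
\<close>

definition g0_term :: "nat \<Rightarrow> (nat \<Rightarrow> complex) \<Rightarrow> (nat \<Rightarrow> complex) \<Rightarrow> nat \<Rightarrow> complex" where
  "g0_term p a b k =
     (let s = param_s p a b in
      pochhammer s k * rGamma (a 1 + s + of_nat k) * rGamma (a 2 + s + of_nat k) * coeff_A p a b k)"

definition g0 :: "nat \<Rightarrow> (nat \<Rightarrow> complex) \<Rightarrow> (nat \<Rightarrow> complex) \<Rightarrow> complex" where
  "g0 p a b = Gamma (a 1) * Gamma (a 2) * Gamma (param_s p a b) * (\<Sum>k. g0_term p a b k)"

definition hyp_partial_sum :: "nat \<Rightarrow> (nat \<Rightarrow> complex) \<Rightarrow> (nat \<Rightarrow> complex) \<Rightarrow> nat \<Rightarrow> complex" where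
  "hyp_partial_sum p a b m =
     (\<Sum>l<m. (\<Prod>j=1..p+1. Gamma (a j + of_nat l))
             * (\<Prod>j=1..p. rGamma (b j + of_nat l)) * rGamma (1 + of_nat l))"

text \<open>
  For \<open>k \<le> n\<close> the quotient $(a_i+s)_n/(a_i+s)_k$ is read as $(a_i+s+k)_{n-k}$.
\<close>

definition expansion_sum ::
  "nat \<Rightarrow> (nat \<Rightarrow> complex) \<Rightarrow> (nat \<Rightarrow> complex) \<Rightarrow> nat \<Rightarrow> nat \<Rightarrow> complex" where
  "expansion_sum p a b N m =
     (let s = param_s p a b in
      \<Sum>n=0..N. (-1) ^ n * (1 / (s + of_nat n)) * (1 / pochhammer 1 n)
        * (Gamma (- s - of_nat n + of_nat m) / Gamma (of_nat m))
        * (\<Sum>k=0..n. pochhammer (- of_nat n) k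
              * pochhammer (a 1 + s + of_nat k) (n - k)
              * pochhammer (a 2 + s + of_nat k) (n - k)
              * coeff_A p a b k))"

end

theory Submission
  imports Defs
begin

text \<open>
  Write \<open>s\<close> for \<open>param_s p a b\<close> and put \<open>c = a\<^sub>1 + a\<^sub>2 + s\<close>, the sum of all \<open>b\<^sub>j\<close> minus the sum of
  the \<open>a\<^sub>j\<close> with \<open>j \<ge> 3\<close>. The coefficients \<open>A\<^sub>k\<close> are those of an inverse factorial series: for
  every \<open>l\<close>, the product of the \<open>\<Gamma>(a\<^sub>j + l)\<close> with \<open>j \<ge> 3\<close>, divided by the product of the
  \<open>\<Gamma>(b\<^sub>j + l)\<close>, equals the sum over \<open>k\<close> of \<open>A\<^sub>k / \<Gamma>(c + l + k)\<close> (\<open>coeff_A_abs_sums\<close>). Summing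
  over \<open>l < m\<close> turns the hypergeometric partial sum into the sum over \<open>k\<close> of \<open>A\<^sub>k\<close> times a partial
  sum of Gauss's series with upper parameters \<open>a\<^sub>1, a\<^sub>2\<close> and lower parameter \<open>c + k\<close>, that is, with
  \<open>s\<close> replaced by \<open>s + k\<close>. Such a partial sum has an explicit asymptotic expansion
  (\<open>gauss_partial_sum_expansion\<close>) whose constant term, times \<open>A\<^sub>k\<close>, is the \<open>k\<close>-th term of \<open>g\<^sub>0(0)\<close>.

  The indices \<open>k \<le> N\<close> are expanded one by one, each up to the order \<open>N + 1 - k\<close>; reordering the
  resulting double sum by \<open>n + k\<close> gives the claimed expansion (\<open>expansion_sum_eq\<close>). For \<open>k > N\<close>
  the real part of \<open>s + k\<close> is positive, so Gauss's series converges, the sums over \<open>k\<close> and \<open>l\<close> may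
  be exchanged (\<open>abs_sums_swap\<close>), and the terms with \<open>l \<ge> m\<close> contribute the error term
  (\<open>limit_remainder_bigo\<close>).

  Two points need an idea.

  The constant term of the partial sums of Gauss's series has to be identified also where the
  series diverges. Raising the lower parameter by one changes the partial sum by an explicit boundary
  term (\<open>gauss_contiguous\<close>), so an induction on the length of the expansion reduces everything to the
  convergent case, where \<open>gauss_hypergeometric_sum\<close> applies. The boundary term is a quotient of
  Gamma functions, which has its own expansion (\<open>gamma_quotient_expansion\<close>).

  The inverse factorial series arises by induction on \<open>p\<close>: one step of the recursion multiplies its
  sum by \<open>\<Gamma>(a\<^sub>3) / \<Gamma>(b\<^sub>1)\<close>, by Gauss's theorem and an exchange of summations
  (\<open>coeff_step_abs_sums\<close>). But the double series converges absolutely only if the real part of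
  \<open>\<delta> = b\<^sub>1 - a\<^sub>3\<close> is positive. Otherwise \<open>b\<^sub>1\<close> is raised by splitting \<open>b\<^sub>1 + z\<close> as
  \<open>(a\<^sub>4 + z) + (b\<^sub>1 - a\<^sub>4)\<close>: on the level of coefficients this expresses \<open>A\<^sub>k\<close> through the
  coefficients for \<open>(a\<^sub>4 + 1, b\<^sub>1 + 1)\<close> and for \<open>(a\<^sub>4, b\<^sub>1 + 1)\<close> (\<open>coeff_step_exchange\<close>). The
  real parts of the \<open>a\<^sub>j\<close> never decrease, hence no convergence is lost, and after finitely many steps
  \<open>\<delta>\<close> has positive real part (\<open>coeff_step_family_abs_sums\<close>).
\<close>

section \<open>Powers, Gamma quotients and remainders of limits\<close>

text \<open>
  Euler's product for the Gamma function. It covers the poles, where the quotients vanish eventually;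
  comparing with \<open>\<Gamma>(n) n\<^sup>z\<close> instead of a factorial keeps all later comparisons in one shape.
\<close>

lemma pochhammer_LIMSEQ_rGamma:
  fixes z :: complex
  shows "(\<lambda>n. pochhammer z n / (Gamma (of_nat n) * of_nat n powr z)) \<longlonglongrightarrow> rGamma z"
proof -
  have lim: "(\<lambda>n. inverse (Gamma_series' z n)) \<longlonglongrightarrow> rGamma z"
  proof (cases "z \<in> \<int>\<^sub>\<le>\<^sub>0")
    case True
    then obtain k where k: "z = - of_nat k" by (elim nonpos_Ints_cases')
    have "eventually (\<lambda>n. inverse (Gamma_series' z n) = 0) sequentially"
      unfolding k using Gamma_series'_minus_of_nat by (rule eventually_mono) auto
    then have "(\<lambda>n. inverse (Gamma_series' z n)) \<longlonglongrightarrow> 0" by (rule tendsto_eventually)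
    moreover have "rGamma z = 0" using True by (simp add: rGamma_eq_zero_iff)
    ultimately show ?thesis by (simp only:)
  next
    case False
    then show ?thesis
      using tendsto_inverse[OF Gamma_series'_LIMSEQ[of z]] 
      by (simp add: Gamma_eq_zero_iff rGamma_inverse_Gamma)
  qed
  have "eventually (\<lambda>n. inverse (Gamma_series' z n)
          = pochhammer z n / (Gamma (of_nat n) * of_nat n powr z)) sequentially"
    using eventually_gt_at_top[of 0]
  proof eventually_elim
    case (elim n)
    then obtain k where k: "n = Suc k" by (cases n) auto
    have "Gamma (of_nat n :: complex) = fact (n - 1)"
      unfolding k by (simp add: Gamma_fact)
    with elim show ?case
      by (simp add: Gamma_series'_def powr_def Ln_of_nat)
  qed
  from Lim_transform_eventually[OF lim this] show ?thesis .
qed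

text \<open>
  Away from the poles this is Euler's product divided by its limit. If \<open>z\<close> is a pole, the functional
  equation passes the limit from \<open>z + 1\<close> to \<open>z\<close>, starting from the trivial case \<open>z = 0\<close>.
\<close>

lemma Gamma_shift_LIMSEQ:
  fixes z :: complex
  shows "(\<lambda>n. Gamma (z + of_nat n) / (Gamma (of_nat n) * of_nat n powr z)) \<longlonglongrightarrow> 1"
proof -
  have shift: "(\<lambda>n. Gamma (w + of_nat n) / (Gamma (of_nat n) * of_nat n powr w)) \<longlonglongrightarrow> 1"
    if w: "w \<notin> \<int>\<^sub>\<le>\<^sub>0" for w :: complex
  proof -
    have "(\<lambda>n. Gamma w * (pochhammer w n / (Gamma (of_nat n) * of_nat n powr w)))
            \<longlonglongrightarrow> Gamma w * rGamma w"
      by (intro tendsto_mult tendsto_const pochhammer_LIMSEQ_rGamma)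
    moreover have "Gamma w * rGamma w = 1"
      using w by (simp add: rGamma_inverse_Gamma Gamma_eq_zero_iff)
    ultimately show ?thesis
      using w by (simp add: pochhammer_Gamma Gamma_eq_zero_iff)
  qed
  have down: "(\<lambda>n. Gamma (w + of_nat n) / (Gamma (of_nat n) * of_nat n powr w)) \<longlonglongrightarrow> 1"
    if "(\<lambda>n. Gamma (w + 1 + of_nat n) / (Gamma (of_nat n) * of_nat n powr (w + 1))) \<longlonglongrightarrow> 1"
    for w :: complex
  proof -
    have "(\<lambda>n. inverse (w / of_nat n + 1)) \<longlonglongrightarrow> inverse (0 + 1)"
      by (intro tendsto_intros lim_const_over_n) auto
    then have L1: "(\<lambda>n. inverse (w / of_nat n + 1) * (Gamma (w + 1 + of_nat n)
                 / (Gamma (of_nat n) * of_nat n powr (w + 1)))) \<longlonglongrightarrow> 1 * 1"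
      using that by (intro tendsto_mult) simp_all
    have L2: "eventually (\<lambda>n. inverse (w / of_nat n + 1) * (Gamma (w + 1 + of_nat n)
                 / (Gamma (of_nat n) * of_nat n powr (w + 1)))
               = Gamma (w + of_nat n) / (Gamma (of_nat n) * of_nat n powr w)) sequentially"
      using eventually_gt_at_top[of "nat \<lceil>norm w\<rceil>"] eventually_gt_at_top[of 0]
    proof eventually_elim
      case (elim n)
      have nz: "w + of_nat n \<notin> \<int>\<^sub>\<le>\<^sub>0"
      proof
        assume "w + of_nat n \<in> \<int>\<^sub>\<le>\<^sub>0"
        then have "Re (w + of_nat n) \<le> 0" by (elim nonpos_Ints_cases') simp
        moreover have "\<bar>Re w\<bar> \<le> norm w" by (rule abs_Re_le_cmod)
        ultimately show False using elim by simp linarith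
      qed
      then have nz': "w + of_nat n \<noteq> 0" by auto
      have G: "Gamma (w + 1 + of_nat n) = (w + of_nat n) * Gamma (w + of_nat n)"
        using Gamma_plus1[OF nz] by (simp add: algebra_simps)
      have quot: "inverse (w / of_nat n + 1) = of_nat n / (w + of_nat n)"
        using elim by (simp add: field_simps)
      have "(of_nat n :: complex) powr (w + 1) = of_nat n powr w * of_nat n"
        using elim by (simp add: powr_add)
      then show ?case
        unfolding G quot using nz' elim(2) by simp
    qed
    show ?thesis using Lim_transform_eventually[OF L1 L2] by (simp only: mult_1)
  qed
  show "(\<lambda>n. Gamma (z + of_nat n) / (Gamma (of_nat n) * of_nat n powr z)) \<longlonglongrightarrow> 1"
  proof (cases "z \<in> \<int>\<^sub>\<le>\<^sub>0")
    case True
    then obtain k where z: "z = - of_nat k" by (elim nonpos_Ints_cases')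
    show ?thesis unfolding z
    proof (induction k)
      case 0
      have "eventually (\<lambda>n. Gamma (- of_nat 0 + of_nat n) / (Gamma (of_nat n) * of_nat n powr (- of_nat 0)) = (1::complex)) sequentially"
        using eventually_gt_at_top[of 0] by eventually_elim (auto simp: Gamma_eq_zero_iff of_nat_in_nonpos_Ints_iff)
      then show ?case by (rule tendsto_eventually)
    next
      case (Suc k)
      have "- of_nat (Suc k) + 1 = (- of_nat k :: complex)" by simp
      then show ?case using down[of "- of_nat (Suc k)"] Suc by (simp only:)
    qed
  qed (rule shift)
qed

lemma Gamma_shift_asymp_equiv:
  fixes z :: complex
  shows "(\<lambda>n. Gamma (z + of_nat n)) \<sim>[sequentially] (\<lambda>n. Gamma (of_nat n) * of_nat n powr z)"
  by (rule asymp_equivI', rule Gamma_shift_LIMSEQ)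

text \<open>
  Every asymptotic estimate below is a product of instances of this one and of
  \<open>pochhammer_rGamma_bigo\<close>, whose exponents add up.
\<close>

lemma Gamma_rGamma_shift_asymp_equiv:
  fixes u v :: complex
  shows "(\<lambda>n. Gamma (u + of_nat n) * rGamma (v + of_nat n)) \<sim>[sequentially] (\<lambda>n. of_nat n powr (u - v))"
proof -
  have eq: "(\<lambda>n. Gamma (u + of_nat n) * rGamma (v + of_nat n)) = (\<lambda>n. Gamma (u + of_nat n) / Gamma (v + of_nat n))"
    by (simp add: rGamma_inverse_Gamma divide_inverse)
  have e1: "(\<lambda>n. Gamma (u + of_nat n) / Gamma (v + of_nat n)) \<sim>[sequentially]
      (\<lambda>n. (Gamma (of_nat n) * of_nat n powr u) / (Gamma (of_nat n) * of_nat n powr v))"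
    by (rule asymp_equiv_divide[OF Gamma_shift_asymp_equiv Gamma_shift_asymp_equiv])
  have e2: "(\<lambda>n. (Gamma (of_nat n) * of_nat n powr u) / (Gamma (of_nat n) * of_nat n powr v))
      \<sim>[sequentially] (\<lambda>n. of_nat n powr (u - v))"
    by (rule asymp_equiv_refl_ev, use eventually_gt_at_top[of 0] in eventually_elim)
       (auto simp: Gamma_eq_zero_iff of_nat_in_nonpos_Ints_iff powr_diff)
  show ?thesis unfolding eq by (rule asymp_equiv_trans[OF e1 e2])
qed

lemma pochhammer_rGamma_bigo:
  fixes u v :: complex
  shows "(\<lambda>n. pochhammer u n * rGamma (v + of_nat n)) \<in> O(\<lambda>n. of_nat n powr (u - v))"
proof -
  have "(\<lambda>n. pochhammer u n) \<in> O(\<lambda>n. Gamma (of_nat n) * of_nat n powr u)"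
    by (rule bigoI_tendsto[OF pochhammer_LIMSEQ_rGamma], use eventually_gt_at_top[of 0] in eventually_elim)
       (simp add: Gamma_eq_zero_iff of_nat_in_nonpos_Ints_iff)
  moreover have "(\<lambda>n. rGamma (v + of_nat n)) \<in> O(\<lambda>n. inverse (Gamma (of_nat n) * of_nat n powr v))"
    unfolding rGamma_inverse_Gamma
    by (rule asymp_equiv_imp_bigo[OF asymp_equiv_inverse[OF Gamma_shift_asymp_equiv]])
  ultimately have *: "(\<lambda>n. pochhammer u n * rGamma (v + of_nat n))
      \<in> O(\<lambda>n. (Gamma (of_nat n) * of_nat n powr u) * inverse (Gamma (of_nat n) * of_nat n powr v))"
    by (rule landau_o.big.mult)
  have "O(\<lambda>n. (Gamma (of_nat n) * of_nat n powr u) * inverse (Gamma (of_nat n) * of_nat n powr v))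
      = O(\<lambda>n. of_nat n powr (u - v) :: complex)"
    by (rule landau_o.big.cong, use eventually_gt_at_top[of 0] in eventually_elim)
       (simp add: Gamma_eq_zero_iff of_nat_in_nonpos_Ints_iff powr_diff divide_inverse)
  from *[unfolded this] show ?thesis .
qed

lemma summable_norm_powr_bigo:
  fixes f :: "nat \<Rightarrow> complex"
  assumes f: "f \<in> O(\<lambda>n. of_nat n powr e)" and e: "Re e < -1"
  shows "summable (\<lambda>n. norm (f n))"
proof -
  obtain C where "eventually (\<lambda>n. norm (f n) \<le> C * norm (of_nat n powr e :: complex)) sequentially"
    using landau_o.bigE[OF f] by blast
  then have ev: "eventually (\<lambda>n. norm (norm (f n)) \<le> C * real n powr Re e) sequentially"
    by (simp add: norm_powr_real_powr)
  show ?thesis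
    by (rule summable_comparison_test_ev[OF ev], intro summable_mult)
       (use e in \<open>simp add: summable_real_powr_iff\<close>)
qed

text \<open>
  The mean value theorem compares \<open>n\<^sup>-\<^sup>r\<^sup>-\<^sup>1\<close> with a difference of consecutive values of \<open>n\<^sup>-\<^sup>r\<close>, so that
  remainders can be summed by telescoping.
\<close>

lemma powr_telescope_bound:
  fixes r :: real
  assumes "r > 0"
  obtains c where "c > 0"
    "\<And>n. n > 0 \<Longrightarrow> real n powr (-r - 1) \<le> c * (real n powr (-r) - real (Suc n) powr (-r))"
proof
  show "2 powr (r + 1) / r > 0" using assms by simp
  fix n :: nat assume n: "n > 0"
  have "\<exists>z>real n. z < real (Suc n) \<and> real (Suc n) powr (-r) - real n powr (-r)
           = (real (Suc n) - real n) * (-r * z powr (-r - 1))"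
    by (rule MVT2) (use n in \<open>auto intro!: derivative_eq_intros\<close>)
  then obtain z where z: "real n < z" "z < real (Suc n)"
    "real n powr (-r) - real (Suc n) powr (-r) = r * z powr (-r - 1)"
    by (auto simp: algebra_simps)
  have "(2 * real n) powr (-r - 1) \<le> z powr (-r - 1)"
    by (rule powr_mono2') (use z n assms in auto)
  then have "real n powr (-r - 1) \<le> 2 powr (r + 1) * z powr (-r - 1)"
    using n by (simp add: powr_mult powr_minus powr_diff powr_add field_simps)
  then show "real n powr (-r - 1)
      \<le> 2 powr (r + 1) / r * (real n powr (-r) - real (Suc n) powr (-r))"
    using assms z(3) by simp
qed

text \<open>
  A sequence inherits a rate of convergence from its differences: the differences beyond \<open>n\<close> are
  dominated by a telescoping sum. This bounds every error term that is the tail of a series.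
\<close>

lemma limit_remainder_bigo:
  fixes f :: "nat \<Rightarrow> complex"
  assumes diff: "(\<lambda>n. f (Suc n) - f n) \<in> O(\<lambda>n. of_nat n powr (-q - 1))"
    and q: "Re q > 0" and lim: "f \<longlonglongrightarrow> L"
  shows "(\<lambda>n. f n - L) \<in> O(\<lambda>n. of_nat n powr (-q))"
proof -
  obtain C where C: "C > 0" and ev: "eventually (\<lambda>n. norm (f (Suc n) - f n)
      \<le> C * norm (of_nat n powr (-q - 1) :: complex)) sequentially"
    using landau_o.bigE[OF diff] by blast
  obtain n0 where n0: "\<And>n. n \<ge> n0 \<Longrightarrow> norm (f (Suc n) - f n) \<le> C * real n powr (-Re q - 1)"
    using ev by (auto simp: eventually_sequentially norm_powr_real_powr)
  obtain c where c: "c > 0" "\<And>n. n > 0 \<Longrightarrow> real n powr (-Re q - 1)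
      \<le> c * (real n powr (-Re q) - real (Suc n) powr (-Re q))"
    using powr_telescope_bound[OF q] by blast
  have "norm (f n - L) \<le> C * c * real n powr (-Re q)" if n: "n \<ge> Suc n0" for n
  proof -
    have part: "norm (f (n + k) - f n) \<le> C * c * (real n powr (-Re q) - real (n + k) powr (-Re q))" for k
    proof (induction k)
      case (Suc k)
      have "norm (f (Suc (n + k)) - f (n + k)) \<le> C * real (n + k) powr (-Re q - 1)"
        by (rule n0) (use n in simp)
      also have "\<dots> \<le> C * (c * (real (n + k) powr (-Re q) - real (Suc (n + k)) powr (-Re q)))"
        by (rule mult_left_mono[OF c(2)]) (use n C in auto)
      finally have *: "norm (f (Suc (n + k)) - f (n + k))
          \<le> C * c * (real (n + k) powr (-Re q) - real (Suc (n + k)) powr (-Re q))"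
        by (simp add: mult.assoc)
      have "norm (f (n + Suc k) - f n)
          \<le> norm (f (Suc (n + k)) - f (n + k)) + norm (f (n + k) - f n)"
        using norm_triangle_ineq[of "f (Suc (n + k)) - f (n + k)" "f (n + k) - f n"] by simp
      also note add_mono[OF * Suc.IH]
      finally show ?case by (simp add: algebra_simps)
    qed simp
    have "(\<lambda>k. norm (f (k + n) - f n)) \<longlonglongrightarrow> norm (L - f n)"
      by (intro tendsto_intros LIMSEQ_ignore_initial_segment lim)
    moreover have "norm (f (k + n) - f n) \<le> C * c * real n powr (-Re q)" for k
    proof -
      have "C * c * (real n powr (-Re q) - real (n + k) powr (-Re q)) \<le> C * c * real n powr (-Re q)"
        by (rule mult_left_mono) (use C c(1) in auto)
      with part[of k] show ?thesis by (simp add: add.commute)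
    qed
    ultimately have "norm (L - f n) \<le> C * c * real n powr (-Re q)"
      by (intro LIMSEQ_le_const2) auto
    then show ?thesis by (simp add: norm_minus_commute)
  qed
  then have "eventually (\<lambda>n. norm (f n - L) \<le> C * c * norm (of_nat n powr (-q) :: complex)) sequentially"
    by (auto simp: eventually_sequentially norm_powr_real_powr)
  then show ?thesis by (rule bigoI)
qed

lemma tendsto_0_powr_bigo:
  fixes f :: "nat \<Rightarrow> complex"
  assumes f: "f \<in> O(\<lambda>n. of_nat n powr e)" and e: "Re e < 0"
  shows "f \<longlonglongrightarrow> 0"
proof -
  obtain C where "eventually (\<lambda>n. norm (f n) \<le> C * norm (of_nat n powr e :: complex)) sequentially"
    using landau_o.bigE[OF f] by blast
  then have ev: "eventually (\<lambda>n. norm (f n) \<le> C * real n powr Re e) sequentially"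
    by (simp add: norm_powr_real_powr)
  have "(\<lambda>n. C * real n powr Re e) \<longlonglongrightarrow> C * 0"
    by (intro tendsto_mult tendsto_const tendsto_neg_powr filterlim_real_sequentially e)
  then have "(\<lambda>n. C * real n powr Re e) \<longlonglongrightarrow> 0" by (simp only: mult_zero_right)
  from Lim_null_comparison[OF ev this] show ?thesis .
qed

text \<open>
  Moving a point of the right half-plane to the right increases the modulus of every factor. This makes
  \<open>1 / pochhammer c k\<close> a majorant, uniform in \<open>n\<close>, of its translates.
\<close>

lemma norm_pochhammer_mono:
  fixes c :: complex
  assumes "Re c \<ge> 0"
  shows "norm (pochhammer c k) \<le> norm (pochhammer (c + of_nat n) k)"
proof (induction k)
  case (Suc k)
  have "norm (c + of_nat k) \<le> norm (c + of_nat n + of_nat k)"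
    using assms by (simp add: cmod_def power_mono)
  with Suc show ?case by (simp add: pochhammer_Suc norm_mult mult_mono)
qed simp

lemma Re_pos_notin_nonpos_Ints: "Re z > 0 \<Longrightarrow> z \<notin> \<int>\<^sub>\<le>\<^sub>0"
  by (auto elim!: nonpos_Ints_cases')

lemma rGamma_one_plus_nat: "rGamma (1 + of_nat n :: complex) = 1 / fact n"
  by (simp add: rGamma_inverse_Gamma Gamma_fact divide_inverse)

lemma bigo_eventually_cong: "f \<in> O(g) \<Longrightarrow> eventually (\<lambda>n. f n = h n) sequentially \<Longrightarrow> h \<in> O(g)"
  for f g h :: "nat \<Rightarrow> complex"
  using landau_o.big.in_cong[of f h] by blast

lemma bigo_cmult: "f \<in> O(g) \<Longrightarrow> (\<lambda>n. c * f n) \<in> O(g)"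
  for f g :: "nat \<Rightarrow> complex"
  by (cases "c = 0") simp_all

lemma bigo_powr_mult:
  fixes f g :: "nat \<Rightarrow> complex"
  assumes "f \<in> O(\<lambda>n. of_nat n powr u)" "g \<in> O(\<lambda>n. of_nat n powr v)" "e = u + v"
  shows "(\<lambda>n. f n * g n) \<in> O(\<lambda>n. of_nat n powr e)"
  using landau_o.big.mult[OF assms(1,2)] by (simp only: assms(3) powr_add)

lemma eventually_shift_notin_nonpos_Ints:
  "eventually (\<lambda>n. z + of_nat n \<notin> \<int>\<^sub>\<le>\<^sub>0) sequentially" for z :: complex
proof -
  obtain n0 :: nat where "- Re z < real n0"
    using reals_Archimedean2 by blast
  then show ?thesis
    using eventually_ge_at_top[of n0]
    by (elim eventually_rev_mp) (auto intro!: always_eventually Re_pos_notin_nonpos_Ints)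
qed

section \<open>Gauss's summation theorem\<close>

text \<open>
  The contiguous relation of Gauss's series, with the boundary term that appears when the series is
  truncated. The factor \<open>rGamma (of_nat m)\<close> makes the boundary term vanish at \<open>m = 0\<close>.
\<close>

lemma gauss_contiguous:
  fixes x y c :: complex
  shows "(c - x) * (c - y) * (\<Sum>l<m. pochhammer x l * pochhammer y l / fact l * rGamma (c + 1 + of_nat l))
       - (c - x - y) * (\<Sum>l<m. pochhammer x l * pochhammer y l / fact l * rGamma (c + of_nat l))
       = pochhammer x m * pochhammer y m * rGamma (of_nat m) * rGamma (c + of_nat m)"
proof (induction m)
  case (Suc m)
  define r P where "r = rGamma (c + 1 + of_nat m)" and "P = pochhammer x m * pochhammer y m / fact m"
  have r: "rGamma (c + of_nat m) = (c + of_nat m) * r"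
    using rGamma_plus1[of "c + of_nat m"] by (simp add: r_def algebra_simps)
  have m1: "rGamma (of_nat (Suc m) :: complex) = 1 / fact m"
    using rGamma_one_plus_nat[of m] by simp
  then have m0: "rGamma (of_nat m :: complex) = of_nat m / fact m"
    using rGamma_plus1[of "of_nat m :: complex"] by (simp add: add.commute)
  have "pochhammer x (Suc m) * pochhammer y (Suc m) * rGamma (of_nat (Suc m)) * rGamma (c + of_nat (Suc m))
      = P * ((x + of_nat m) * (y + of_nat m)) * r"
    unfolding m1 by (simp add: P_def r_def pochhammer_Suc mult_ac add_ac)
  also have "\<dots> = P * of_nat m * (c + of_nat m) * r
      + ((c - x) * (c - y) * (P * r) - (c - x - y) * (P * ((c + of_nat m) * r)))"
    by (simp add: algebra_simps)
  also have "P * of_nat m * (c + of_nat m) * r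
      = pochhammer x m * pochhammer y m * rGamma (of_nat m) * rGamma (c + of_nat m)"
    unfolding m0 r by (simp add: P_def)
  finally have step: "pochhammer x (Suc m) * pochhammer y (Suc m) * rGamma (of_nat (Suc m)) * rGamma (c + of_nat (Suc m))
      = pochhammer x m * pochhammer y m * rGamma (of_nat m) * rGamma (c + of_nat m)
        + ((c - x) * (c - y) * (P * r) - (c - x - y) * (P * rGamma (c + of_nat m)))"
    by (simp only: r)
  have split: "A * (S + u) - B * (T + v) = (A * S - B * T) + (A * u - B * v)" for A B S T u v :: complex
    by (simp add: algebra_simps)
  show ?case
    unfolding step sum.lessThan_Suc split Suc.IH r_def P_def by (rule refl)
qed simp

lemma gauss_term_bigo:
  fixes x y c :: complex
  shows "(\<lambda>k. pochhammer x k * pochhammer y k / fact k * rGamma (c + of_nat k))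
    \<in> O(\<lambda>k. of_nat k powr (x + y - c - 1))"
proof -
  have "(\<lambda>k. (pochhammer x k * rGamma (c + of_nat k)) * (pochhammer y k * rGamma (1 + of_nat k)))
      \<in> O(\<lambda>k. of_nat k powr (x - c) * of_nat k powr (y - 1))"
    by (intro landau_o.big.mult pochhammer_rGamma_bigo)
  then show ?thesis
    by (simp add: rGamma_one_plus_nat powr_add[symmetric] algebra_simps)
qed

lemma gauss_summable:
  fixes x y c :: complex
  assumes "Re (c - x - y) > 0"
  shows "summable (\<lambda>k. norm (pochhammer x k * pochhammer y k / fact k * rGamma (c + of_nat k)))"
  by (rule summable_norm_powr_bigo[OF gauss_term_bigo]) (use assms in simp)

text \<open>
  Letting \<open>m\<close> tend to infinity in the contiguous relation removes the boundary term. Iterating it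
  moves \<open>c\<close> to \<open>c + n\<close>, where the series is dominated by its first term as \<open>n\<close> tends to infinity; the
  factors collected on the way converge to the Gamma values by Euler's product. Dividing by \<open>\<Gamma>(c)\<close>
  throughout admits all values of \<open>c\<close>.
\<close>

theorem gauss_hypergeometric_sum:
  fixes x y c :: complex
  assumes \<sigma>: "Re (c - x - y) > 0"
  shows "(\<lambda>k. pochhammer x k * pochhammer y k / fact k * rGamma (c + of_nat k)) sums
           (Gamma (c - x - y) * rGamma (c - x) * rGamma (c - y))"
proof -
  define t where "t = (\<lambda>c k. pochhammer x k * pochhammer y k / fact k * rGamma (c + of_nat k))"
  define H where "H = (\<lambda>c. \<Sum>k. t c k)"
  have abs_summable: "summable (\<lambda>k. norm (t c k))" if "Re (c - x - y) > 0" for c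
    unfolding t_def by (rule gauss_summable[OF that])
  have sums: "t c sums H c" if "Re (c - x - y) > 0" for c
    unfolding H_def by (rule summable_sums[OF summable_norm_cancel[OF abs_summable[OF that]]])
  have rec: "(c - x) * (c - y) * H (c + 1) = (c - x - y) * H c" if c: "Re (c - x - y) > 0" for c
  proof -
    have "(\<lambda>m. (pochhammer x m * rGamma (c + of_nat m)) * (pochhammer y m * rGamma (0 + of_nat m)))
      \<in> O(\<lambda>k. of_nat k powr (x - c) * of_nat k powr (y - 0))"
      by (intro landau_o.big.mult pochhammer_rGamma_bigo)
    then have "(\<lambda>m. pochhammer x m * pochhammer y m * rGamma (of_nat m) * rGamma (c + of_nat m))
      \<in> O(\<lambda>k. of_nat k powr (x - c + y))"
      by (simp add: powr_add[symmetric] ac_simps)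
    then have "(\<lambda>m. pochhammer x m * pochhammer y m * rGamma (of_nat m) * rGamma (c + of_nat m)) \<longlonglongrightarrow> 0"
      by (rule tendsto_0_powr_bigo) (use c in simp)
    moreover have "(\<lambda>m. (c - x) * (c - y) * (\<Sum>l<m. t (c + 1) l) - (c - x - y) * (\<Sum>l<m. t c l))
      \<longlonglongrightarrow> (c - x) * (c - y) * H (c + 1) - (c - x - y) * H c"
      using sums[of c] sums[of "c + 1"] c unfolding sums_def by (intro tendsto_intros) simp_all
    ultimately have "(c - x) * (c - y) * H (c + 1) - (c - x - y) * H c = 0"
      unfolding t_def gauss_contiguous by (rule LIMSEQ_unique[rotated])
    then show ?thesis by simp
  qed
  have iter: "H c * pochhammer (c - x - y) n = pochhammer (c - x) n * pochhammer (c - y) n * H (c + of_nat n)" for n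
  proof (induction n)
    case (Suc n)
    have "H c * pochhammer (c - x - y) (Suc n)
        = (pochhammer (c - x) n * pochhammer (c - y) n * H (c + of_nat n)) * (c - x - y + of_nat n)"
      by (simp add: Suc.IH[symmetric] pochhammer_Suc)
    also have "\<dots> = pochhammer (c - x) n * pochhammer (c - y) n * ((c + of_nat n - x - y) * H (c + of_nat n))"
      by (simp add: algebra_simps)
    also have "(c + of_nat n - x - y) * H (c + of_nat n)
        = (c + of_nat n - x) * (c + of_nat n - y) * H (c + of_nat n + 1)"
      by (rule rec[symmetric]) (use \<sigma> in simp)
    finally show ?case by (simp add: pochhammer_Suc algebra_simps)
  qed simp
  obtain n0 :: nat where "- Re c < real n0"
    using reals_Archimedean2 by blast
  then have n0: "Re c + real n0 > 0" by linarith
  \<comment> \<open>Only the first term of the series survives in the limit.\<close>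
  have lim1: "(\<lambda>n. H (c + of_nat n) * Gamma (c + of_nat n)) \<longlonglongrightarrow> 1"
  proof -
    define M where "M = (\<lambda>k. norm (t (c + of_nat n0) k) * norm (Gamma (c + of_nat n0)))"
    have "(\<lambda>n. \<Sum>k. t (c + of_nat n) k * Gamma (c + of_nat n)) \<longlonglongrightarrow> (\<Sum>k. if k = 0 then 1 else 0 :: complex)"
    proof (rule tannerys_theorem[THEN conjunct2, THEN conjunct2])
      show "summable M"
        unfolding M_def by (intro summable_mult2 abs_summable) (use \<sigma> in simp)
      show "(\<lambda>n. t (c + of_nat n) k * Gamma (c + of_nat n)) \<longlonglongrightarrow> (if k = 0 then 1 else 0)" for k
      proof (cases "k = 0")
        case True
        have "eventually (\<lambda>n. t (c + of_nat n) k * Gamma (c + of_nat n) = 1) sequentially"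
          using eventually_ge_at_top[of n0]
        proof eventually_elim
          case (elim n)
          then have "c + of_nat n \<notin> \<int>\<^sub>\<le>\<^sub>0" by (intro Re_pos_notin_nonpos_Ints) (use n0 in simp)
          with True show ?case by (simp add: t_def rGamma_inverse_Gamma Gamma_eq_zero_iff)
        qed
        from tendsto_eventually[OF this] True show ?thesis by simp
      next
        case False
        have "(\<lambda>n. Gamma (c + of_nat n) * rGamma (c + of_nat k + of_nat n)) \<longlonglongrightarrow> 0"
          by (rule tendsto_0_powr_bigo[OF asymp_equiv_imp_bigo[OF Gamma_rGamma_shift_asymp_equiv]])
             (use False in simp)
        from tendsto_mult_left[OF this, of "pochhammer x k * pochhammer y k / fact k"] False
        show ?thesis by (simp add: t_def ac_simps)
      qed
      have "norm (t (c + of_nat n) k * Gamma (c + of_nat n)) \<le> M k" if n: "n \<ge> n0" for n k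
      proof -
        have G: "rGamma (c + of_nat n + of_nat k) * Gamma (c + of_nat n) = 1 / pochhammer (c + of_nat n) k"
          if "n \<ge> n0" for n
        proof -
          have *: "c + of_nat n \<notin> \<int>\<^sub>\<le>\<^sub>0"
            by (intro Re_pos_notin_nonpos_Ints) (use n0 that in simp)
          show ?thesis using pochhammer_Gamma[OF *, of k] *
            by (simp add: rGamma_inverse_Gamma Gamma_eq_zero_iff divide_inverse)
        qed
        have "norm (pochhammer (c + of_nat n0) k) \<le> norm (pochhammer (c + of_nat n0 + of_nat (n - n0)) k)"
          by (rule norm_pochhammer_mono) (use n0 in simp)
        then have le: "norm (pochhammer (c + of_nat n0) k) \<le> norm (pochhammer (c + of_nat n) k)"
          using n by (simp add: of_nat_diff)
        have "pochhammer (c + of_nat n0) k \<noteq> 0"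
          using n0 pochhammer_eq_0_imp_nonpos_Int Re_pos_notin_nonpos_Ints[of "c + of_nat n0"] by auto
        then have "norm (1 / pochhammer (c + of_nat n) k) \<le> norm (1 / pochhammer (c + of_nat n0) k)"
          using le by (simp add: norm_divide frac_le)
        then have "norm (pochhammer x k * pochhammer y k / fact k) * norm (rGamma (c + of_nat n + of_nat k) * Gamma (c + of_nat n))
             \<le> norm (pochhammer x k * pochhammer y k / fact k) * norm (rGamma (c + of_nat n0 + of_nat k) * Gamma (c + of_nat n0))"
          using n by (intro mult_left_mono) (simp_all add: G)
        then show ?thesis by (simp only: M_def t_def norm_mult mult.assoc)
      qed
      then show "eventually (\<lambda>(k, n). norm (t (c + of_nat n) k * Gamma (c + of_nat n)) \<le> M k) (sequentially \<times>\<^sub>F sequentially)"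
        unfolding eventually_prod_sequentially by blast
    qed simp
    moreover have "(\<Sum>k. if k = 0 then 1 else 0 :: complex) = 1"
      using sums_single[of 0 "\<lambda>_. 1 :: complex"] by (simp add: sums_iff)
    moreover have "(\<Sum>k. t (c + of_nat n) k * Gamma (c + of_nat n)) = H (c + of_nat n) * Gamma (c + of_nat n)" for n
      unfolding H_def
      by (rule suminf_mult2[symmetric], rule summable_norm_cancel, rule abs_summable) (use \<sigma> in simp)
    ultimately show ?thesis by simp
  qed
  define L where "L = (\<lambda>z n. pochhammer z n / (Gamma (of_nat n) * of_nat n powr z) :: complex)"
  have "(\<lambda>n. (L (c - x) n * L (c - y) n) / (L (c - x - y) n * (Gamma (c + of_nat n) / (Gamma (of_nat n) * of_nat n powr c)))
      * (H (c + of_nat n) * Gamma (c + of_nat n)))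
    \<longlonglongrightarrow> (rGamma (c - x) * rGamma (c - y)) / (rGamma (c - x - y) * 1) * 1"
    unfolding L_def using \<sigma> Re_pos_notin_nonpos_Ints[OF \<sigma>]
    by (intro tendsto_intros pochhammer_LIMSEQ_rGamma Gamma_shift_LIMSEQ lim1) (auto simp: rGamma_eq_zero_iff)
  moreover have ev: "eventually (\<lambda>n. (L (c - x) n * L (c - y) n) / (L (c - x - y) n * (Gamma (c + of_nat n) / (Gamma (of_nat n) * of_nat n powr c)))
      * (H (c + of_nat n) * Gamma (c + of_nat n)) = H c) sequentially"
    using eventually_ge_at_top[of n0] eventually_gt_at_top[of 0]
  proof eventually_elim
    case (elim n)
    define g where "g = Gamma (of_nat n :: complex)"
    have g: "g \<noteq> 0" "Gamma (c + of_nat n) \<noteq> 0"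
      using elim n0 by (auto simp: g_def Gamma_eq_zero_iff of_nat_in_nonpos_Ints_iff intro!: Re_pos_notin_nonpos_Ints)
    have nz: "(of_nat n :: complex) powr z \<noteq> 0" for z using elim by simp
    have poch: "pochhammer (c - x - y) n \<noteq> 0"
      using \<sigma> Re_pos_notin_nonpos_Ints[OF \<sigma>] by (meson pochhammer_eq_0_imp_nonpos_Int)
    have pw: "(of_nat n :: complex) powr (c - x) * of_nat n powr (c - y) = of_nat n powr (c - x - y) * of_nat n powr c"
      by (simp add: powr_add[symmetric])
    have "(L (c - x) n * L (c - y) n) / (L (c - x - y) n * (Gamma (c + of_nat n) / (g * of_nat n powr c)))
      * (H (c + of_nat n) * Gamma (c + of_nat n))
      = (pochhammer (c - x) n * pochhammer (c - y) n * H (c + of_nat n)) / pochhammer (c - x - y) n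
        * ((of_nat n powr (c - x - y) * of_nat n powr c) / (of_nat n powr (c - x) * of_nat n powr (c - y)))"
      unfolding L_def g_def[symmetric] using g by (simp add: divide_simps)
    also have "\<dots> = H c"
      unfolding iter[symmetric] pw using nz poch by simp
    finally show ?case by (simp add: g_def)
  qed
  ultimately have "H c = rGamma (c - x) * rGamma (c - y) / (rGamma (c - x - y) * 1) * 1"
    using LIMSEQ_unique[OF tendsto_eventually[OF ev]] by blast
  with sums[OF \<sigma>] show ?thesis
    by (simp add: t_def[abs_def] rGamma_inverse_Gamma divide_inverse ac_simps)
qed

section \<open>Expansion of a quotient of Gamma functions\<close>

text \<open>
  The coefficients of the expansion of \<open>\<Gamma>(\<alpha> + z) \<Gamma>(\<beta> + z) / \<Gamma>(\<alpha> + \<beta> + z)\<close> in the functions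
  \<open>\<Gamma>(z - n)\<close>.
\<close>

definition quotient_coeff :: "complex \<Rightarrow> complex \<Rightarrow> nat \<Rightarrow> complex" where
  "quotient_coeff \<alpha> \<beta> n = (-1) ^ n * pochhammer \<alpha> n * pochhammer \<beta> n / fact n"

lemma quotient_coeff_Suc:
  "of_nat (Suc n) * quotient_coeff \<alpha> \<beta> (Suc n) = - ((\<alpha> + of_nat n) * (\<beta> + of_nat n) * quotient_coeff \<alpha> \<beta> n)"
proof -
  have "quotient_coeff \<alpha> \<beta> (Suc n) = - ((\<alpha> + of_nat n) * (\<beta> + of_nat n) * quotient_coeff \<alpha> \<beta> n) / of_nat (Suc n)"
    by (simp add: quotient_coeff_def pochhammer_Suc mult_ac)
  then show ?thesis by (simp del: of_nat_Suc)
qed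

text \<open>
  The quotient \<open>V(z) = \<Gamma>(\<alpha> + z) \<Gamma>(\<beta> + z) / \<Gamma>(\<alpha> + \<beta> + z)\<close> satisfies
  \<open>(\<alpha> + \<beta> + z) V(z + 1) = (\<alpha> + z) (\<beta> + z) V(z)\<close>. The truncated expansion satisfies this equation
  up to a single term, because the defects of the individual terms telescope.
\<close>

lemma quotient_coeff_telescope:
  fixes \<alpha> \<beta> z :: complex
  assumes z: "z \<notin> \<int>"
  shows "(\<alpha> + \<beta> + z) * (\<Sum>n<K. quotient_coeff \<alpha> \<beta> n * Gamma (z + 1 - of_nat n))
       - (\<alpha> + z) * (\<beta> + z) * (\<Sum>n<K. quotient_coeff \<alpha> \<beta> n * Gamma (z - of_nat n))
       = of_nat K * quotient_coeff \<alpha> \<beta> K * Gamma (z + 1 - of_nat K)"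
proof (induction K)
  case (Suc K)
  define g where "g = Gamma (z - of_nat K)"
  have "z - of_nat K \<notin> \<int>\<^sub>\<le>\<^sub>0"
    using z Ints_add[of "z - of_nat K" "of_nat K"] nonpos_Ints_Int by auto
  then have g1: "Gamma (z + 1 - of_nat K) = (z - of_nat K) * g"
    using Gamma_plus1[of "z - of_nat K"] by (simp add: g_def algebra_simps)
  have split: "A * (S + u) - B * (T + v) = (A * S - B * T) + (A * u - B * v)" for A B S T u v :: complex
    by (simp add: algebra_simps)
  have "z + 1 - of_nat (Suc K) = z - of_nat K" by simp
  then have rhs: "of_nat (Suc K) * quotient_coeff \<alpha> \<beta> (Suc K) * Gamma (z + 1 - of_nat (Suc K))
      = - ((\<alpha> + of_nat K) * (\<beta> + of_nat K) * quotient_coeff \<alpha> \<beta> K) * g"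
    by (simp only: quotient_coeff_Suc g_def)
  show ?case
    unfolding sum.lessThan_Suc split Suc.IH rhs g1 unfolding g_def[symmetric] by (simp add: algebra_simps)
qed simp

text \<open>
  Put \<open>z = m - (c - x - y)\<close> and let \<open>K > 0\<close>. The truncated expansion divided by the quotient itself tends
  to one, and by \<open>quotient_coeff_telescope\<close> its consecutive values differ by a term of order \<open>-K - 1\<close> in
  \<open>m\<close>; therefore it differs from one by a term of order \<open>-K\<close>.
\<close>

lemma gamma_quotient_expansion:
  fixes x y c :: complex
  assumes \<sigma>: "c - x - y \<notin> \<int>"
  shows "(\<lambda>m. Gamma (x + of_nat m) * Gamma (y + of_nat m) * rGamma (c + of_nat m) * rGamma (of_nat m)
      - (\<Sum>n<K. quotient_coeff (c - x) (c - y) n * Gamma (of_nat m - (c - x - y) - of_nat n)) * rGamma (of_nat m))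
    \<in> O(\<lambda>m. of_nat m powr (- (c - x - y) - of_nat K))"
proof -
  define V where "V = (\<lambda>m. Gamma (x + of_nat m) * Gamma (y + of_nat m) * rGamma (c + of_nat m))"
  define U where "U = (\<lambda>m. \<Sum>n<K. quotient_coeff (c - x) (c - y) n * Gamma (of_nat m - (c - x - y) - of_nat n))"
  have "(\<lambda>m. (Gamma (x + of_nat m) * rGamma (c + of_nat m)) * (Gamma (y + of_nat m) * rGamma (0 + of_nat m)))
      \<in> O(\<lambda>m. of_nat m powr (x - c) * of_nat m powr (y - 0))"
    by (intro landau_o.big.mult asymp_equiv_imp_bigo Gamma_rGamma_shift_asymp_equiv)
  then have V: "(\<lambda>m. V m * rGamma (of_nat m)) \<in> O(\<lambda>m. of_nat m powr (- (c - x - y)))"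
    by (simp add: V_def powr_add[symmetric] mult_ac add_ac algebra_simps)
  show ?thesis
  proof (cases "K = 0")
    case True
    then show ?thesis using V by (simp add: V_def)
  next
    case K: False
    \<comment> \<open>\<open>W\<close> is eventually the reciprocal of \<open>V\<close>.\<close>
    define W where "W = (\<lambda>m. Gamma (c + of_nat m) * rGamma (x + of_nat m) * rGamma (y + of_nat m))"
    have VW: "eventually (\<lambda>m. V m * W m = 1) sequentially"
      using eventually_shift_notin_nonpos_Ints[of x] eventually_shift_notin_nonpos_Ints[of y]
        eventually_shift_notin_nonpos_Ints[of c]
      by eventually_elim (simp add: V_def W_def rGamma_inverse_Gamma Gamma_eq_zero_iff field_simps)
    have diff: "eventually (\<lambda>m. of_nat K * quotient_coeff (c - x) (c - y) K
          * ((Gamma (1 - of_nat K - (c - x - y) + of_nat m) * rGamma (x + 1 + of_nat m))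
             * (Gamma (c + of_nat m) * rGamma (y + 1 + of_nat m)))
        = U (Suc m) * W (Suc m) - U m * W m) sequentially"
      using eventually_shift_notin_nonpos_Ints[of x] eventually_shift_notin_nonpos_Ints[of y]
        eventually_shift_notin_nonpos_Ints[of c]
    proof eventually_elim
      case (elim m)
      define z where "z = of_nat m - (c - x - y)"
      have "z \<notin> \<int>"
      proof
        assume "z \<in> \<int>"
        then have "of_nat m - z \<in> \<int>" by (intro Ints_diff Ints_of_nat)
        moreover have "of_nat m - z = c - x - y" by (simp add: z_def)
        ultimately show False using \<sigma> by (simp only:)
      qed
      from quotient_coeff_telescope[OF this, of "c - x" "c - y" K]
      have tele: "(c + of_nat m) * U (Suc m) - (y + of_nat m) * (x + of_nat m) * U m
          = of_nat K * quotient_coeff (c - x) (c - y) K * Gamma (z + 1 - of_nat K)"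
        by (simp add: U_def z_def algebra_simps)
      define r where "r = Gamma (c + of_nat m) * rGamma (x + 1 + of_nat m) * rGamma (y + 1 + of_nat m)"
      have W1: "W (Suc m) = (c + of_nat m) * r"
        using Gamma_plus1[OF elim(3)] by (simp add: W_def r_def add_ac)
      have W0: "W m = (y + of_nat m) * (x + of_nat m) * r"
        using rGamma_plus1[of "x + of_nat m"] rGamma_plus1[of "y + of_nat m"]
        by (simp add: W_def r_def add_ac mult_ac)
      have "U (Suc m) * W (Suc m) - U m * W m
          = ((c + of_nat m) * U (Suc m) - (y + of_nat m) * (x + of_nat m) * U m) * r"
        unfolding W1 W0 by (simp add: algebra_simps)
      then show ?case
        unfolding tele r_def z_def by (simp add: add_ac mult_ac diff_diff_eq add_diff_eq algebra_simps)
    qed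
    have "(\<lambda>m. of_nat K * quotient_coeff (c - x) (c - y) K
          * ((Gamma (1 - of_nat K - (c - x - y) + of_nat m) * rGamma (x + 1 + of_nat m))
             * (Gamma (c + of_nat m) * rGamma (y + 1 + of_nat m))))
       \<in> O(\<lambda>m. of_nat m powr (- of_nat K - 1))"
      by (rule bigo_cmult, rule bigo_powr_mult, (rule asymp_equiv_imp_bigo, rule Gamma_rGamma_shift_asymp_equiv)+) simp
    from bigo_eventually_cong[OF this diff]
    have diffO: "(\<lambda>m. U (Suc m) * W (Suc m) - U m * W m) \<in> O(\<lambda>m. of_nat m powr (- of_nat K - 1))" .
    have "(\<lambda>m. \<Sum>n<K. quotient_coeff (c - x) (c - y) n
            * ((Gamma (- (c - x - y) - of_nat n + of_nat m) * rGamma (x + of_nat m))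
               * (Gamma (c + of_nat m) * rGamma (y + of_nat m))))
        \<longlonglongrightarrow> (\<Sum>n<K. quotient_coeff (c - x) (c - y) n * (if n = 0 then 1 else 0))"
    proof (intro tendsto_sum tendsto_mult[OF tendsto_const])
      fix n
      have e: "(\<lambda>m. (Gamma (- (c - x - y) - of_nat n + of_nat m) * rGamma (x + of_nat m))
               * (Gamma (c + of_nat m) * rGamma (y + of_nat m)))
          \<sim>[sequentially] (\<lambda>m. of_nat m powr ((- (c - x - y) - of_nat n) - x) * of_nat m powr (c - y))"
        by (rule asymp_equiv_mult[OF Gamma_rGamma_shift_asymp_equiv Gamma_rGamma_shift_asymp_equiv])
      have p: "(\<lambda>m. of_nat m powr ((- (c - x - y) - of_nat n) - x) * of_nat m powr (c - y))
          = (\<lambda>m. of_nat m powr (- of_nat n) :: complex)"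
        by (simp add: powr_add[symmetric] algebra_simps)
      show "(\<lambda>m. (Gamma (- (c - x - y) - of_nat n + of_nat m) * rGamma (x + of_nat m))
               * (Gamma (c + of_nat m) * rGamma (y + of_nat m))) \<longlonglongrightarrow> (if n = 0 then 1 else 0)"
      proof (cases "n = 0")
        case True
        have "eventually (\<lambda>m. (of_nat m powr (- of_nat n) :: complex) = 1) sequentially"
          using eventually_gt_at_top[of 0] by eventually_elim (use True in simp)
        then have "(\<lambda>m. of_nat m powr (- of_nat n) :: complex) \<longlonglongrightarrow> 1"
          by (rule tendsto_eventually)
        from asymp_equiv_tendsto_transfer[OF asymp_equiv_symI[OF e[unfolded p]] this] True
        show ?thesis by simp
      next
        case False
        with tendsto_0_powr_bigo[OF asymp_equiv_imp_bigo[OF e[unfolded p]]] show ?thesis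
          by simp
      qed
    qed
    also have "(\<Sum>n<K. quotient_coeff (c - x) (c - y) n * (if n = 0 then 1 else 0)) = 1"
      using K by (simp add: if_distrib cong: if_cong) (simp add: quotient_coeff_def)
    also have "(\<lambda>m. \<Sum>n<K. quotient_coeff (c - x) (c - y) n
            * ((Gamma (- (c - x - y) - of_nat n + of_nat m) * rGamma (x + of_nat m))
               * (Gamma (c + of_nat m) * rGamma (y + of_nat m)))) = (\<lambda>m. U m * W m)"
      unfolding U_def W_def sum_distrib_right
      by (intro ext sum.cong refl) (simp add: algebra_simps)
    finally have UW: "(\<lambda>m. U m * W m) \<longlonglongrightarrow> 1" .
    have "(\<lambda>m. U m * W m - 1) \<in> O(\<lambda>m. of_nat m powr (- of_nat K))"
      by (rule limit_remainder_bigo[OF diffO _ UW]) (use K in simp)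
    from landau_o.big.mult[OF landau_o.big.uminus_in_iff[THEN iffD2, OF this] V]
    have "(\<lambda>m. - (U m * W m - 1) * (V m * rGamma (of_nat m)))
      \<in> O(\<lambda>m. of_nat m powr (- (c - x - y) - of_nat K))"
      by (simp add: powr_add[symmetric] algebra_simps)
    moreover have "eventually (\<lambda>m. - (U m * W m - 1) * (V m * rGamma (of_nat m))
        = V m * rGamma (of_nat m) - U m * rGamma (of_nat m)) sequentially"
      using VW
    proof eventually_elim
      case (elim m)
      have "- (U m * W m - 1) * (V m * rGamma (of_nat m))
          = V m * rGamma (of_nat m) - U m * rGamma (of_nat m) * (V m * W m)"
        by (simp add: algebra_simps)
      then show ?case unfolding elim by simp
    qed
    ultimately show ?thesis
      unfolding U_def V_def by (rule bigo_eventually_cong)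
  qed
qed

section \<open>Partial sums of Gauss's series\<close>

text \<open>
  Induction on the number \<open>K\<close> of terms, for all \<open>c\<close> at once. Without terms the assumption says that the
  series converges, and the claim bounds its tail. Otherwise \<open>gauss_contiguous\<close> expresses the partial
  sum through that for \<open>c + 1\<close>, for which one term less suffices, and through a Gamma quotient, which
  is expanded by \<open>gamma_quotient_expansion\<close>.
\<close>

lemma gauss_partial_sum_expansion:
  fixes x y c :: complex
  assumes x: "x \<notin> \<int>\<^sub>\<le>\<^sub>0" and y: "y \<notin> \<int>\<^sub>\<le>\<^sub>0"
    and "c - x - y \<notin> \<int>" and "Re (c - x - y) + real K > 0"
  shows "(\<lambda>m. (\<Sum>l<m. pochhammer x l * pochhammer y l / fact l * rGamma (c + of_nat l))
      - (Gamma (c - x - y) * rGamma (c - x) * rGamma (c - y)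
         - rGamma x * rGamma y * (\<Sum>n<K. quotient_coeff (c - x) (c - y) n / (c - x - y + of_nat n)
             * (Gamma (of_nat m - (c - x - y) - of_nat n) * rGamma (of_nat m)))))
    \<in> O(\<lambda>m. of_nat m powr (- (c - x - y) - of_nat K))"
  using assms(3,4)
proof (induction K arbitrary: c)
  case 0
  define S where "S = (\<lambda>m. \<Sum>l<m. pochhammer x l * pochhammer y l / fact l * rGamma (c + of_nat l))"
  have "(\<lambda>m. S m - Gamma (c - x - y) * rGamma (c - x) * rGamma (c - y)) \<in> O(\<lambda>m. of_nat m powr (- (c - x - y)))"
  proof (rule limit_remainder_bigo)
    show "(\<lambda>n. S (Suc n) - S n) \<in> O(\<lambda>n. of_nat n powr (- (c - x - y) - 1))"
      using gauss_term_bigo[of x y c] by (simp add: S_def algebra_simps)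
    show "S \<longlonglongrightarrow> Gamma (c - x - y) * rGamma (c - x) * rGamma (c - y)"
      using gauss_hypergeometric_sum[of c x y] 0 by (simp add: S_def sums_def)
  qed (use 0 in simp)
  then show ?case by (simp add: S_def)
next
  case (Suc K)
  define \<sigma> \<alpha> \<beta> where "\<sigma> = c - x - y" and "\<alpha> = c - x" and "\<beta> = c - y"
  define S where "S = (\<lambda>c m. \<Sum>l<m. pochhammer x l * pochhammer y l / fact l * rGamma (c + of_nat l))"
  define G where "G = (\<lambda>n m. Gamma (of_nat m - \<sigma> - of_nat n) * rGamma (of_nat m))"
  define \<rho> where "\<rho> = rGamma x * rGamma y"
  define w where "w = (\<lambda>m. Gamma (x + of_nat m) * Gamma (y + of_nat m) * rGamma (c + of_nat m) * rGamma (of_nat m))"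
  define E1 where "E1 = (\<lambda>m. \<Sum>n<K. quotient_coeff (\<alpha> + 1) (\<beta> + 1) n / (\<sigma> + 1 + of_nat n) * G (Suc n) m)"
  define U where "U = (\<lambda>m. \<Sum>n<Suc K. quotient_coeff \<alpha> \<beta> n * G n m)"
  have \<sigma>nz: "\<sigma> + of_nat n \<noteq> 0" for n
  proof
    assume "\<sigma> + of_nat n = 0"
    then have "\<sigma> = - of_nat n" by (simp add: eq_neg_iff_add_eq_0)
    then show False using Suc.prems(1) by (simp add: \<sigma>_def)
  qed
  from \<sigma>nz[of 0] have \<sigma>0: "\<sigma> \<noteq> 0" by simp
  have nonint: "\<sigma> + 1 \<notin> \<int>"
  proof
    assume "\<sigma> + 1 \<in> \<int>"
    then have "\<sigma> + 1 - 1 \<in> \<int>" by (intro Ints_diff) auto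
    then show False using Suc.prems(1) by (simp add: \<sigma>_def)
  qed
  have simps: "c + 1 - x = \<alpha> + 1" "\<alpha> + 1 - y = \<sigma> + 1" "c + 1 - y = \<beta> + 1"
    by (simp_all add: \<sigma>_def \<alpha>_def \<beta>_def)
  have shift: "Gamma (of_nat m - (\<sigma> + 1) - of_nat n) * rGamma (of_nat m) = G (Suc n) m" for n m
    by (simp add: G_def algebra_simps)
  have "(\<lambda>m. S (c + 1) m - (Gamma (\<sigma> + 1) * rGamma (\<alpha> + 1) * rGamma (\<beta> + 1) - \<rho> * E1 m))
      \<in> O(\<lambda>m. of_nat m powr (- (\<sigma> + 1) - of_nat K))"
  proof -
    have "Re (\<sigma> + 1) + real K > 0" using Suc.prems(2) by (simp add: \<sigma>_def)
    from Suc.IH[of "c + 1", unfolded simps, OF nonint this] show ?thesis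
      by (simp only: S_def E1_def \<rho>_def shift)
  qed
  then have O1: "(\<lambda>m. \<alpha> * \<beta> / \<sigma> * (S (c + 1) m - (Gamma (\<sigma> + 1) * rGamma (\<alpha> + 1) * rGamma (\<beta> + 1) - \<rho> * E1 m)))
      \<in> O(\<lambda>m. of_nat m powr (- \<sigma> - of_nat (Suc K)))"
    by (intro bigo_cmult) (simp only: minus_add_distrib of_nat_Suc diff_conv_add_uminus ac_simps)
  have "(\<lambda>m. w m - U m) \<in> O(\<lambda>m. of_nat m powr (- \<sigma> - of_nat (Suc K)))"
    using gamma_quotient_expansion[OF Suc.prems(1), of "Suc K"]
    by (simp only: U_def w_def G_def \<sigma>_def \<alpha>_def \<beta>_def sum_distrib_right mult.assoc)
  then have O2: "(\<lambda>m. \<rho> / \<sigma> * (w m - U m)) \<in> O(\<lambda>m. of_nat m powr (- \<sigma> - of_nat (Suc K)))"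
    by (rule bigo_cmult)
  \<comment> \<open>The claimed expansion obeys the contiguous relation term by term.\<close>
  have E: "(\<Sum>n<Suc K. quotient_coeff \<alpha> \<beta> n / (\<sigma> + of_nat n) * G n m) = \<alpha> * \<beta> / \<sigma> * E1 m + U m / \<sigma>" for m
  proof -
    have step: "quotient_coeff \<alpha> \<beta> (Suc n) / (\<sigma> + of_nat (Suc n)) * G (Suc n) m
        = \<alpha> * \<beta> / \<sigma> * (quotient_coeff (\<alpha> + 1) (\<beta> + 1) n / (\<sigma> + 1 + of_nat n) * G (Suc n) m)
          + quotient_coeff \<alpha> \<beta> (Suc n) * G (Suc n) m / \<sigma>" for n
    proof -
      have "\<alpha> * \<beta> * quotient_coeff (\<alpha> + 1) (\<beta> + 1) n = - of_nat (Suc n) * quotient_coeff \<alpha> \<beta> (Suc n)"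
        by (simp add: quotient_coeff_def pochhammer_rec[of \<alpha>] pochhammer_rec[of \<beta>] del: of_nat_Suc)
      then have rec: "\<alpha> * \<beta> * quotient_coeff (\<alpha> + 1) (\<beta> + 1) n * h = - of_nat (Suc n) * quotient_coeff \<alpha> \<beta> (Suc n) * h" for h
        by (simp only:)
      define D where "D = inverse (\<sigma> + of_nat (Suc n))"
      have D: "D = inverse \<sigma> * (1 - of_nat (Suc n) * D)"
        using \<sigma>0 \<sigma>nz[of "Suc n"] unfolding D_def by (simp add: field_simps del: of_nat_Suc)
      have D': "\<sigma> + 1 + of_nat n = \<sigma> + of_nat (Suc n)" by simp
      have "\<alpha> * \<beta> / \<sigma> * (quotient_coeff (\<alpha> + 1) (\<beta> + 1) n / (\<sigma> + 1 + of_nat n) * G (Suc n) m)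
            + quotient_coeff \<alpha> \<beta> (Suc n) * G (Suc n) m / \<sigma>
          = \<alpha> * \<beta> * quotient_coeff (\<alpha> + 1) (\<beta> + 1) n * (inverse \<sigma> * D * G (Suc n) m)
            + quotient_coeff \<alpha> \<beta> (Suc n) * G (Suc n) m * inverse \<sigma>"
        unfolding D' by (simp add: D_def divide_inverse mult_ac del: of_nat_Suc)
      also have "\<dots> = quotient_coeff \<alpha> \<beta> (Suc n) * G (Suc n) m * (inverse \<sigma> * (1 - of_nat (Suc n) * D))"
        unfolding rec by (simp add: algebra_simps del: of_nat_Suc)
      also have "\<dots> = quotient_coeff \<alpha> \<beta> (Suc n) / (\<sigma> + of_nat (Suc n)) * G (Suc n) m"
        unfolding D[symmetric] by (simp add: D_def divide_inverse mult_ac del: of_nat_Suc)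
      finally show ?thesis by (rule sym)
    qed
    show ?thesis
      unfolding sum.lessThan_Suc_shift E1_def U_def step sum.distrib sum_distrib_left
      by (simp add: quotient_coeff_def[of _ _ 0] add_divide_distrib sum_divide_distrib)
  qed
  have Gm: "Gamma \<sigma> * rGamma \<alpha> * rGamma \<beta> = \<alpha> * \<beta> / \<sigma> * (Gamma (\<sigma> + 1) * rGamma (\<alpha> + 1) * rGamma (\<beta> + 1))"
    using \<sigma>0 rGamma_plus1[of \<alpha>] rGamma_plus1[of \<beta>] rGamma_plus1[of \<sigma>]
    by (simp add: Gamma_def field_simps)
  have main: "\<alpha> * \<beta> / \<sigma> * (S (c + 1) m - (Gamma (\<sigma> + 1) * rGamma (\<alpha> + 1) * rGamma (\<beta> + 1) - \<rho> * E1 m))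
        - \<rho> / \<sigma> * (w m - U m)
      = S c m - (Gamma \<sigma> * rGamma \<alpha> * rGamma \<beta> - \<rho> * (\<Sum>n<Suc K. quotient_coeff \<alpha> \<beta> n / (\<sigma> + of_nat n) * G n m))" for m
  proof -
    have "\<rho> * w m = pochhammer x m * pochhammer y m * rGamma (of_nat m) * rGamma (c + of_nat m)"
      using x y by (simp add: \<rho>_def w_def pochhammer_Gamma rGamma_inverse_Gamma divide_inverse)
    also have "\<dots> = \<alpha> * \<beta> * S (c + 1) m - \<sigma> * S c m"
      using gauss_contiguous[of c x y m] by (simp add: S_def \<sigma>_def \<alpha>_def \<beta>_def)
    finally have "S c m = \<alpha> * \<beta> / \<sigma> * S (c + 1) m - \<rho> / \<sigma> * w m"
      using \<sigma>0 by (simp add: field_simps)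
    then show ?thesis
      unfolding E Gm by (simp add: algebra_simps)
  qed
  have "(\<lambda>m. S c m - (Gamma \<sigma> * rGamma \<alpha> * rGamma \<beta> - \<rho> * (\<Sum>n<Suc K. quotient_coeff \<alpha> \<beta> n / (\<sigma> + of_nat n) * G n m)))
      \<in> O(\<lambda>m. of_nat m powr (- \<sigma> - of_nat (Suc K)))"
    using sum_in_bigo(2)[OF O1 O2] unfolding main .
  then show ?case
    by (simp only: S_def \<sigma>_def \<alpha>_def \<beta>_def \<rho>_def G_def)
qed

section \<open>Absolutely convergent series and double series\<close>

definition abs_sums :: "(nat \<Rightarrow> complex) \<Rightarrow> complex \<Rightarrow> bool" where
  "abs_sums f S \<longleftrightarrow> summable (\<lambda>n. norm (f n)) \<and> f sums S"

lemma abs_sums_has_sum: "abs_sums f S \<Longrightarrow> (f has_sum S) UNIV"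
  by (simp add: abs_sums_def norm_summable_imp_has_sum)

text \<open>
  Fubini's theorem for series, in the form needed for the two rearrangements that follow: summation
  along the antidiagonals and exchange of the order of summation.
\<close>

lemma abs_sums_double_has_sum:
  fixes f :: "nat \<Rightarrow> nat \<Rightarrow> complex"
  assumes rows: "\<And>j. abs_sums (f j) (r j)"
    and norms: "summable (\<lambda>j. \<Sum>i. norm (f j i))"
  shows "case_prod f abs_summable_on (UNIV \<times> UNIV)" and "(case_prod f has_sum (\<Sum>j. r j)) (UNIV \<times> UNIV)"
proof -
  have row_norm: "((\<lambda>i. norm (f j i)) has_sum (\<Sum>i. norm (f j i))) UNIV" for j
    using rows[of j] by (intro norm_summable_imp_has_sum) (simp_all add: abs_sums_def summable_sums)
  show abs: "case_prod f abs_summable_on (UNIV \<times> UNIV)"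
    unfolding abs_summable_on_Sigma_iff
  proof (intro conjI ballI)
    show "(\<lambda>y. case_prod f (j, y)) abs_summable_on UNIV" for j
      using row_norm[of j] by (auto simp: summable_on_def)
    have eq: "infsum (\<lambda>y. norm (case_prod f (j, y))) UNIV = (\<Sum>i. norm (f j i))" for j
      using infsumI[OF row_norm] by (simp only: case_prod_conv)
    show "(\<lambda>j. infsum (\<lambda>y. norm (case_prod f (j, y))) UNIV) abs_summable_on UNIV"
      unfolding eq using norms rows by (simp add: summable_on_UNIV_nonneg_real_iff suminf_nonneg abs_sums_def)
  qed
  have "norm (r j) \<le> (\<Sum>i. norm (f j i))" for j
    using summable_norm[of "f j"] rows[of j] by (simp add: abs_sums_def sums_iff)
  then have r: "summable (\<lambda>j. norm (r j))"
    by (intro summable_comparison_test'[OF norms]) simp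
  show "(case_prod f has_sum (\<Sum>j. r j)) (UNIV \<times> UNIV)"
  proof (rule has_sum_SigmaI)
    show "((\<lambda>y. case_prod f (j, y)) has_sum r j) UNIV" for j
      using abs_sums_has_sum[OF rows[of j]] by simp
    show "(r has_sum (\<Sum>j. r j)) UNIV"
      by (intro norm_summable_imp_has_sum r summable_sums summable_norm_cancel[OF r])
    show "case_prod f summable_on UNIV \<times> UNIV"
      by (rule abs_summable_summable[OF abs])
  qed
qed

lemma abs_sums_triangle:
  fixes f :: "nat \<Rightarrow> nat \<Rightarrow> complex"
  assumes rows: "\<And>j. abs_sums (f j) (r j)"
    and norms: "summable (\<lambda>j. \<Sum>i. norm (f j i))"
  shows "abs_sums (\<lambda>k. \<Sum>j=0..k. f j (k - j)) (\<Sum>j. r j)"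
proof -
  define h where "h = (\<lambda>(k, j). (j, k - j) :: nat \<times> nat)"
  have bij: "bij_betw h (SIGMA k:UNIV. {0..k}) (UNIV \<times> UNIV)"
    by (rule bij_betwI[where g = "\<lambda>(j, i). (j + i, j)"]) (auto simp: h_def)
  note double = abs_sums_double_has_sum[OF rows norms]
  have has: "((\<lambda>z. case_prod f (h z)) has_sum (\<Sum>j. r j)) (SIGMA k:UNIV. {0..k})"
    using double(2) by (simp only: has_sum_reindex_bij_betw[OF bij])
  have "(\<lambda>z. case_prod f (h z)) abs_summable_on (SIGMA k:UNIV. {0..k})"
    using double(1) summable_on_reindex_bij_betw[OF bij, of "\<lambda>z. norm (case_prod f z)"] by simp
  then have "(\<lambda>k. infsum (\<lambda>j. norm (case_prod f (h (k, j)))) {0..k}) abs_summable_on UNIV"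
    unfolding abs_summable_on_Sigma_iff by (rule conjunct2)
  from summable_on_imp_summable[OF abs_summable_summable[OF this]]
  have "summable (\<lambda>k. \<Sum>j=0..k. norm (f j (k - j)))"
    by (simp add: h_def)
  then have "summable (\<lambda>k. norm (\<Sum>j=0..k. f j (k - j)))"
    by (rule summable_comparison_test') (simp add: norm_sum)
  moreover have "((\<lambda>k. \<Sum>j=0..k. f j (k - j)) has_sum (\<Sum>j. r j)) UNIV"
    by (rule has_sum_SigmaD[OF has]) (auto simp: h_def intro!: has_sum_finiteI)
  ultimately show ?thesis
    by (simp add: abs_sums_def has_sum_imp_sums)
qed

lemma abs_sums_swap:
  fixes f :: "nat \<Rightarrow> nat \<Rightarrow> complex"
  assumes rows: "\<And>j. abs_sums (f j) (r j)"
    and norms: "summable (\<lambda>j. \<Sum>i. norm (f j i))"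
    and columns: "\<And>i. (\<lambda>j. f j i) sums q i"
  shows "abs_sums q (\<Sum>j. r j)"
proof -
  have bij: "bij_betw prod.swap (UNIV \<times> UNIV) (UNIV \<times> UNIV :: (nat \<times> nat) set)"
    by (rule bij_betwI[where g = prod.swap]) auto
  note double = abs_sums_double_has_sum[OF rows norms]
  have has: "((\<lambda>z. case_prod f (prod.swap z)) has_sum (\<Sum>j. r j)) (UNIV \<times> UNIV)"
    using double(2) by (simp only: has_sum_reindex_bij_betw[OF bij])
  have "(\<lambda>z. case_prod f (prod.swap z)) abs_summable_on (UNIV \<times> UNIV)"
    using double(1) summable_on_reindex_bij_betw[OF bij, of "\<lambda>z. norm (case_prod f z)"] by simp
  then have "(\<forall>i\<in>UNIV. (\<lambda>j. case_prod f (prod.swap (i, j))) abs_summable_on UNIV)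
      \<and> (\<lambda>i. infsum (\<lambda>j. norm (case_prod f (prod.swap (i, j)))) UNIV) abs_summable_on UNIV"
    unfolding abs_summable_on_Sigma_iff .
  then have col: "\<And>i. (\<lambda>j. norm (f j i)) summable_on UNIV"
    and tot: "(\<lambda>i. infsum (\<lambda>j. norm (f j i)) UNIV) summable_on UNIV"
    using abs_summable_summable by (simp, fastforce)
  have colsum: "((\<lambda>j. f j i) has_sum q i) UNIV" for i
    using norm_summable_imp_has_sum[OF summable_on_imp_summable[OF col[of i]] columns[of i]] .
  have "summable (\<lambda>i. norm (q i))"
  proof (rule summable_comparison_test'[OF summable_on_imp_summable[OF tot]])
    show "norm (norm (q i)) \<le> infsum (\<lambda>j. norm (f j i)) UNIV" for i
      using norm_infsum_bound[OF col[of i]] unfolding infsumI[OF colsum[of i]] by simp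
  qed
  moreover have "(q has_sum (\<Sum>j. r j)) UNIV"
    by (rule has_sum_SigmaD[OF has]) (use colsum in simp)
  ultimately show ?thesis
    by (simp add: abs_sums_def has_sum_imp_sums)
qed

lemma abs_sums_cmult: "abs_sums f S \<Longrightarrow> abs_sums (\<lambda>n. c * f n) (c * S)"
  by (simp add: abs_sums_def norm_mult sums_mult)

lemma abs_sums_add:
  assumes "abs_sums f S" "abs_sums g T"
  shows "abs_sums (\<lambda>n. f n + g n) (S + T)"
proof -
  have "summable (\<lambda>n. norm (f n + g n))"
    by (rule summable_comparison_test'[where g = "\<lambda>n. norm (f n) + norm (g n)"])
       (use assms in \<open>auto simp: abs_sums_def norm_triangle_ineq intro: summable_add\<close>)
  then show ?thesis
    using assms by (simp add: abs_sums_def sums_add)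
qed

lemma abs_sums_Suc:
  assumes "abs_sums f S"
  shows "abs_sums (\<lambda>n. case n of 0 \<Rightarrow> 0 | Suc k \<Rightarrow> f k) S"
  using assms summable_Suc_iff[of "\<lambda>n. norm (case n of 0 \<Rightarrow> 0 | Suc k \<Rightarrow> f k)"]
    sums_Suc_iff[of "\<lambda>n. case n of 0 \<Rightarrow> 0 | Suc k \<Rightarrow> f k" S]
  by (simp add: abs_sums_def)

lemma abs_sums_split_initial:
  assumes "abs_sums f S"
  shows "abs_sums (\<lambda>i. f (i + n)) (S - (\<Sum>k<n. f k))"
  using assms sums_split_initial_segment[of f S n] summable_ignore_initial_segment[of "\<lambda>i. norm (f i)" n]
  by (simp add: abs_sums_def)

section \<open>The step of the coefficient recursion\<close>

text \<open>
  One step of the recursion of the coefficients, as an operator on arbitrary sequences. If \<open>B\<close> is the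
  result and no \<open>u + j\<close> is a pole of the Gamma function, then the generating function of
  \<open>B k / \<Gamma>(u + k)\<close> is that of \<open>A j / \<Gamma>(u + j)\<close> times the binomial series of \<open>(1 - t)\<close> with exponent
  \<open>-\<delta>\<close>.
\<close>

definition coeff_step :: "complex \<Rightarrow> complex \<Rightarrow> (nat \<Rightarrow> complex) \<Rightarrow> nat \<Rightarrow> complex" where
  "coeff_step u \<delta> A k =
     (\<Sum>j=0..k. pochhammer (u + of_nat j) (k - j) * pochhammer \<delta> (k - j) / fact (k - j) * A j)"

lemma coeff_step_0 [simp]: "coeff_step u \<delta> A 0 = A 0"
  by (simp add: coeff_step_def)

lemma coeff_step_Suc:
  "coeff_step u \<delta> A (Suc k) = (\<Sum>j=0..k. pochhammer (u + of_nat j) (Suc (k - j))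
      * pochhammer \<delta> (Suc (k - j)) / fact (Suc (k - j)) * A j) + A (Suc k)"
proof -
  have "coeff_step u \<delta> A (Suc k) = (\<Sum>j=0..k. pochhammer (u + of_nat j) (Suc k - j)
      * pochhammer \<delta> (Suc k - j) / fact (Suc k - j) * A j) + A (Suc k)"
    by (simp add: coeff_step_def)
  also have "(\<Sum>j=0..k. pochhammer (u + of_nat j) (Suc k - j)
      * pochhammer \<delta> (Suc k - j) / fact (Suc k - j) * A j)
    = (\<Sum>j=0..k. pochhammer (u + of_nat j) (Suc (k - j))
      * pochhammer \<delta> (Suc (k - j)) / fact (Suc (k - j)) * A j)"
    by (intro sum.cong refl) (simp add: Suc_diff_le)
  finally show ?thesis .
qed

text \<open>
  The exponents \<open>-\<delta>\<close> and \<open>-(\<delta> + 1)\<close> of the binomial series differ by a factor \<open>1 - t\<close> of the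
  generating functions.
\<close>

lemma coeff_step_lower:
  "coeff_step u \<delta> A (Suc k)
     = coeff_step u (\<delta> + 1) A (Suc k) - (u + of_nat k) * coeff_step u (\<delta> + 1) A k"
proof -
  have "pochhammer (u + of_nat j) (Suc (k - j)) * pochhammer \<delta> (Suc (k - j)) / fact (Suc (k - j)) * A j
      = pochhammer (u + of_nat j) (Suc (k - j)) * pochhammer (\<delta> + 1) (Suc (k - j)) / fact (Suc (k - j)) * A j
        - (u + of_nat k) * (pochhammer (u + of_nat j) (k - j) * pochhammer (\<delta> + 1) (k - j) / fact (k - j) * A j)"
    if "j \<in> {0..k}" for j
  proof -
    define i P where "i = k - j" and "P = pochhammer (u + of_nat j) i * pochhammer (\<delta> + 1) i * A j / fact (Suc i)"
    have k: "of_nat k = of_nat j + (of_nat i :: complex)"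
      using that by (simp add: i_def of_nat_diff)
    have f: "1 / fact i = (of_nat (Suc i) :: complex) / fact (Suc i)"
      by (simp add: fact_Suc del: of_nat_Suc)
    have 1: "pochhammer (u + of_nat j) (Suc i) * pochhammer \<delta> (Suc i) / fact (Suc i) * A j
        = P * ((u + of_nat k) * \<delta>)"
      by (simp only: pochhammer_rec[of \<delta>] pochhammer_Suc[of "u + of_nat j"] P_def k) (simp add: field_simps)
    have 2: "pochhammer (u + of_nat j) (Suc i) * pochhammer (\<delta> + 1) (Suc i) / fact (Suc i) * A j
        = P * ((u + of_nat k) * (\<delta> + 1 + of_nat i))"
      by (simp only: pochhammer_Suc P_def k) (simp add: field_simps)
    have "pochhammer (u + of_nat j) i * pochhammer (\<delta> + 1) i / fact i * A j
        = pochhammer (u + of_nat j) i * pochhammer (\<delta> + 1) i * A j * (1 / fact i)" by simp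
    then have 3: "pochhammer (u + of_nat j) i * pochhammer (\<delta> + 1) i / fact i * A j = P * of_nat (Suc i)"
      unfolding f P_def by (simp only: times_divide_eq_left times_divide_eq_right mult_ac)
    show ?thesis
      unfolding i_def[symmetric] 1 2 3 by (simp add: algebra_simps)
  qed
  then have "(\<Sum>j=0..k. pochhammer (u + of_nat j) (Suc (k - j)) * pochhammer \<delta> (Suc (k - j)) / fact (Suc (k - j)) * A j)
      = (\<Sum>j=0..k. pochhammer (u + of_nat j) (Suc (k - j)) * pochhammer (\<delta> + 1) (Suc (k - j)) / fact (Suc (k - j)) * A j
        - (u + of_nat k) * (pochhammer (u + of_nat j) (k - j) * pochhammer (\<delta> + 1) (k - j) / fact (k - j) * A j))"
    by (intro sum.cong refl)
  then show ?thesis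
    unfolding coeff_step_Suc sum_subtractf sum_distrib_left[symmetric] coeff_step_def[of _ _ _ k] by simp
qed

text \<open>
  The effect of raising \<open>a\<^sub>3\<close> by one, which lowers both \<open>u\<close> and \<open>\<delta>\<close>. On the level of the inverse
  factorial series it is multiplication by \<open>a\<^sub>3 + z\<close>.
\<close>

lemma coeff_step_raise:
  "coeff_step (u - 1) (\<delta> - 1) A (Suc k)
     = coeff_step u \<delta> A (Suc k) - (u + \<delta> + of_nat k - 1) * coeff_step u \<delta> A k"
proof -
  have "pochhammer (u - 1 + of_nat j) (Suc (k - j)) * pochhammer (\<delta> - 1) (Suc (k - j)) / fact (Suc (k - j)) * A j
      = pochhammer (u + of_nat j) (Suc (k - j)) * pochhammer \<delta> (Suc (k - j)) / fact (Suc (k - j)) * A j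
        - (u + \<delta> + of_nat k - 1) * (pochhammer (u + of_nat j) (k - j) * pochhammer \<delta> (k - j) / fact (k - j) * A j)"
    if "j \<in> {0..k}" for j
  proof -
    define i U P where "i = k - j" and "U = u + of_nat j" and "P = pochhammer U i * pochhammer \<delta> i * A j / fact (Suc i)"
    have k: "u + \<delta> + of_nat k - 1 = U + \<delta> + of_nat i - 1"
      using that by (simp add: i_def U_def of_nat_diff)
    have f: "1 / fact i = (of_nat (Suc i) :: complex) / fact (Suc i)"
      by (simp add: fact_Suc del: of_nat_Suc)
    have U1: "u - 1 + of_nat j = U - 1" by (simp add: U_def)
    have 1: "pochhammer (U - 1) (Suc i) * pochhammer (\<delta> - 1) (Suc i) / fact (Suc i) * A j
        = P * ((U - 1) * (\<delta> - 1))"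
      by (simp only: pochhammer_rec P_def diff_add_cancel) (simp add: field_simps)
    have 2: "pochhammer U (Suc i) * pochhammer \<delta> (Suc i) / fact (Suc i) * A j
        = P * ((U + of_nat i) * (\<delta> + of_nat i))"
      by (simp only: pochhammer_Suc P_def) (simp add: field_simps)
    have "pochhammer U i * pochhammer \<delta> i / fact i * A j
        = pochhammer U i * pochhammer \<delta> i * A j * (1 / fact i)" by simp
    then have 3: "pochhammer U i * pochhammer \<delta> i / fact i * A j = P * of_nat (Suc i)"
      unfolding f P_def by (simp only: times_divide_eq_left times_divide_eq_right mult_ac)
    show ?thesis
      unfolding k U1 i_def[symmetric] U_def[symmetric] 1 2 3 by (simp add: algebra_simps)
  qed
  then have "(\<Sum>j=0..k. pochhammer (u - 1 + of_nat j) (Suc (k - j)) * pochhammer (\<delta> - 1) (Suc (k - j)) / fact (Suc (k - j)) * A j)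
      = (\<Sum>j=0..k. pochhammer (u + of_nat j) (Suc (k - j)) * pochhammer \<delta> (Suc (k - j)) / fact (Suc (k - j)) * A j
        - (u + \<delta> + of_nat k - 1) * (pochhammer (u + of_nat j) (k - j) * pochhammer \<delta> (k - j) / fact (k - j) * A j))"
    by (intro sum.cong refl)
  then show ?thesis
    unfolding coeff_step_Suc sum_subtractf sum_distrib_left[symmetric] coeff_step_def[of _ _ _ k] by simp
qed

text \<open>
  The same relation for a parameter that enters the step only through \<open>u\<close> and through the sequence,
  such as \<open>a\<^sub>4\<close>: if the inner coefficients transform as in \<open>coeff_step_raise\<close>, so do the outer ones.
  Here \<open>e\<close> stands for \<open>a\<^sub>3 - a\<^sub>4\<close>.
\<close>

lemma coeff_step_inner_raise:
  assumes B0: "B 0 = A 0" and BS: "\<And>j. B (Suc j) = A (Suc j) - (u + of_nat j - 1 + e) * A j"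
  shows "coeff_step (u - 1) \<delta> B (Suc k)
     = coeff_step u \<delta> A (Suc k) - (u + of_nat k - 1 + e + \<delta>) * coeff_step u \<delta> A k"
proof -
  define w where "w = (\<lambda>j. pochhammer (u - 1 + of_nat j) (Suc k - j) * pochhammer \<delta> (Suc k - j) / fact (Suc k - j))"
  have coeff: "w j - w (Suc j) * (u + of_nat j - 1 + e)
      = pochhammer (u + of_nat j) (Suc (k - j)) * pochhammer \<delta> (Suc (k - j)) / fact (Suc (k - j))
        - (u + of_nat k - 1 + e + \<delta>) * (pochhammer (u + of_nat j) (k - j) * pochhammer \<delta> (k - j) / fact (k - j))"
    if "j \<in> {0..k}" for j
  proof -
    define i U P where "i = k - j" and "U = u + of_nat j" and "P = pochhammer U i * pochhammer \<delta> i / fact (Suc i)"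
    have k: "u + of_nat k - 1 + e + \<delta> = U + of_nat i - 1 + e + \<delta>"
      using that by (simp add: i_def U_def of_nat_diff)
    have f: "1 / fact i = (of_nat (Suc i) :: complex) / fact (Suc i)"
      by (simp add: fact_Suc del: of_nat_Suc)
    have U1: "u - 1 + of_nat j = U - 1" "u - 1 + of_nat (Suc j) = U" by (simp_all add: U_def)
    have i1: "Suc k - j = Suc i" using that by (simp add: i_def Suc_diff_le)
    have 1: "w j = P * ((U - 1) * (\<delta> + of_nat i))"
      unfolding w_def i1 U1
      by (simp only: pochhammer_rec[of "U - 1"] pochhammer_Suc[of \<delta>] P_def diff_add_cancel) (simp add: field_simps)
    have 2: "pochhammer U (Suc i) * pochhammer \<delta> (Suc i) / fact (Suc i)
        = P * ((U + of_nat i) * (\<delta> + of_nat i))"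
      by (simp only: pochhammer_Suc P_def) (simp add: field_simps)
    have "pochhammer U i * pochhammer \<delta> i / fact i = pochhammer U i * pochhammer \<delta> i * (1 / fact i)" by simp
    then have 3: "pochhammer U i * pochhammer \<delta> i / fact i = P * of_nat (Suc i)"
      unfolding f P_def by (simp only: times_divide_eq_left times_divide_eq_right mult_ac)
    have 4: "w (Suc j) = P * of_nat (Suc i)"
      unfolding w_def U1 diff_Suc_Suc i_def[symmetric] by (rule 3)
    show ?thesis
      unfolding k i_def[symmetric] U_def[symmetric] 1 2 3 4 by (simp add: algebra_simps U_def)
  qed
  have "coeff_step (u - 1) \<delta> B (Suc k) = (\<Sum>j=0..Suc k. w j * B j)"
    by (simp add: coeff_step_def w_def)
  also have "\<dots> = w 0 * A 0 + (\<Sum>j=0..k. w (Suc j) * (A (Suc j) - (u + of_nat j - 1 + e) * A j))"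
    unfolding sum.atLeast0_atMost_Suc_shift by (simp add: B0 BS)
  also have "\<dots> = (w 0 * A 0 + (\<Sum>j=0..k. w (Suc j) * A (Suc j))) - (\<Sum>j=0..k. w (Suc j) * (u + of_nat j - 1 + e) * A j)"
    by (simp only: right_diff_distrib sum_subtractf mult.assoc add_diff_eq)
  also have "w 0 * A 0 + (\<Sum>j=0..k. w (Suc j) * A (Suc j)) = (\<Sum>j=0..Suc k. w j * A j)"
    by (simp only: sum.atLeast0_atMost_Suc_shift o_def)
  also have "\<dots> = (\<Sum>j=0..k. w j * A j) + A (Suc k)"
    by (simp add: w_def)
  also have "\<dots> - (\<Sum>j=0..k. w (Suc j) * (u + of_nat j - 1 + e) * A j)
      = (\<Sum>j=0..k. (w j - w (Suc j) * (u + of_nat j - 1 + e)) * A j) + A (Suc k)"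
    by (simp add: sum_subtractf left_diff_distrib)
  also have "(\<Sum>j=0..k. (w j - w (Suc j) * (u + of_nat j - 1 + e)) * A j)
      = (\<Sum>j=0..k. pochhammer (u + of_nat j) (Suc (k - j)) * pochhammer \<delta> (Suc (k - j)) / fact (Suc (k - j)) * A j
        - (u + of_nat k - 1 + e + \<delta>) * (pochhammer (u + of_nat j) (k - j) * pochhammer \<delta> (k - j) / fact (k - j) * A j))"
    by (intro sum.cong refl) (simp only: coeff left_diff_distrib mult.assoc)
  finally show ?thesis
    unfolding coeff_step_Suc sum_subtractf sum_distrib_left[symmetric] coeff_step_def[of _ _ _ k] by simp
qed

text \<open>
  The coefficient form of \<open>b\<^sub>1 + z = (a\<^sub>4 + z) + (b\<^sub>1 - a\<^sub>4)\<close>, with \<open>\<delta> + e = b\<^sub>1 - a\<^sub>4\<close>. Lowering \<open>b\<^sub>1\<close>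
  alone, as in \<open>coeff_step_lower\<close>, costs a power of \<open>k\<close>; here the unbounded factors of
  \<open>coeff_step_lower\<close> and \<open>coeff_step_inner_raise\<close> cancel.
\<close>

lemma coeff_step_exchange:
  assumes "B 0 = A 0" and "\<And>j. B (Suc j) = A (Suc j) - (u + of_nat j - 1 + e) * A j"
  shows "coeff_step u \<delta> A (Suc k)
     = coeff_step (u - 1) (\<delta> + 1) B (Suc k) + (\<delta> + e) * coeff_step u (\<delta> + 1) A k"
  unfolding coeff_step_inner_raise[of B A u e "\<delta> + 1" k, OF assms] coeff_step_lower[of u \<delta> A k]
  by (simp add: algebra_simps)

section \<open>Inverse factorial series under the recursion step\<close>

text \<open>
  Far to the right, the modulus of the Gamma function is comparable to its value at the real part of the
  argument. Thus sums of moduli can be compared with series with real parameters, which Gauss's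
  theorem evaluates exactly.
\<close>

lemma Gamma_shift_le_Gamma_Re:
  fixes z :: complex
  shows "\<exists>C>0. \<exists>N. \<forall>n\<ge>N. Re z + real n > 0
    \<and> norm (Gamma (z + of_nat n)) \<le> C * Gamma (Re z + real n)
    \<and> norm (rGamma (z + of_nat n)) \<le> C * rGamma (Re z + real n)"
proof -
  define x where "x = complex_of_real (Re z)"
  have bound: "\<exists>C>0. eventually (\<lambda>n. norm (Gamma (v + of_nat n) * rGamma (w + of_nat n)) \<le> C) sequentially"
    if "Re v = Re w" for v w :: complex
  proof -
    obtain C where C: "C > 0" and ev: "eventually (\<lambda>n. norm (Gamma (v + of_nat n) * rGamma (w + of_nat n))
        \<le> C * norm (of_nat n powr (v - w) :: complex)) sequentially"
      using landau_o.bigE[OF asymp_equiv_imp_bigo[OF Gamma_rGamma_shift_asymp_equiv]] by blast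
    have "eventually (\<lambda>n. norm (Gamma (v + of_nat n) * rGamma (w + of_nat n)) \<le> C) sequentially"
      using ev eventually_gt_at_top[of 0]
    proof eventually_elim
      case (elim n)
      then show ?case using that by (simp add: norm_powr_real_powr)
    qed
    with C show ?thesis by blast
  qed
  obtain C1 where C1: "C1 > 0"
    "eventually (\<lambda>n. norm (Gamma (z + of_nat n) * rGamma (x + of_nat n)) \<le> C1) sequentially"
    using bound[of z x] by (auto simp: x_def)
  obtain C2 where C2: "C2 > 0"
    "eventually (\<lambda>n. norm (Gamma (x + of_nat n) * rGamma (z + of_nat n)) \<le> C2) sequentially"
    using bound[of x z] by (auto simp: x_def)
  obtain n0 :: nat where n0: "- Re z < real n0"
    using reals_Archimedean2 by blast
  have "eventually (\<lambda>n. Re z + real n > 0 \<and> norm (Gamma (z + of_nat n)) \<le> (C1 + C2) * Gamma (Re z + real n)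
      \<and> norm (rGamma (z + of_nat n)) \<le> (C1 + C2) * rGamma (Re z + real n)) sequentially"
    using C1(2) C2(2) eventually_ge_at_top[of n0]
  proof eventually_elim
    case (elim n)
    define g where "g = Gamma (Re z + real n)"
    have pos: "Re z + real n > 0" using elim n0 by simp
    then have g: "g > 0" by (simp add: g_def Gamma_real_pos)
    have xn: "x + of_nat n = complex_of_real (Re z + real n)" by (simp add: x_def)
    have G: "Gamma (x + of_nat n) = of_real g"
      unfolding xn g_def Gamma_complex_of_real ..
    have rg: "rGamma (Re z + real n) = 1 / g"
      by (simp add: g_def rGamma_inverse_Gamma divide_inverse)
    have "norm (Gamma (z + of_nat n)) \<le> C1 * g"
      using elim(1) g by (simp add: G rGamma_inverse_Gamma divide_inverse[symmetric] norm_divide pos_divide_le_eq)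
    also have "\<dots> \<le> (C1 + C2) * g"
      using g C2(1) by (intro mult_right_mono) auto
    finally have 1: "norm (Gamma (z + of_nat n)) \<le> (C1 + C2) * g" .
    have "norm (rGamma (z + of_nat n)) \<le> C2 / g"
      using elim(2) g by (simp add: G norm_mult pos_le_divide_eq mult.commute)
    also have "\<dots> \<le> (C1 + C2) / g"
      using g C1(1) by (intro divide_right_mono) auto
    finally have 2: "norm (rGamma (z + of_nat n)) \<le> (C1 + C2) / g" .
    show ?case using pos 1 2 by (simp add: rg g_def)
  qed
  moreover have "C1 + C2 > 0" using C1(1) C2(1) by simp
  ultimately show ?thesis
    unfolding eventually_sequentially by blast
qed

lemma norm_pochhammer_le_pochhammer_Re:
  fixes \<delta> :: complex
  assumes \<delta>: "Re \<delta> > 0"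
  shows "\<exists>C>0. \<forall>n. norm (pochhammer \<delta> n) \<le> C * pochhammer (Re \<delta>) n"
proof -
  obtain C N where C: "C > 0" and bound: "\<And>n. n \<ge> N \<Longrightarrow> norm (Gamma (\<delta> + of_nat n)) \<le> C * Gamma (Re \<delta> + real n)"
    using Gamma_shift_le_Gamma_Re[of \<delta>] by blast
  define K where "K = C * norm (rGamma \<delta>) * Gamma (Re \<delta>)"
  define C' where "C' = 1 + K + (\<Sum>n<N. norm (pochhammer \<delta> n) / pochhammer (Re \<delta>) n)"
  have pos: "pochhammer (Re \<delta>) n > 0" for n using \<delta> by (simp add: pochhammer_pos)
  have K: "K \<ge> 0" using C \<delta> by (simp add: K_def Gamma_real_nonneg)
  have sum0: "(\<Sum>n<N. norm (pochhammer \<delta> n) / pochhammer (Re \<delta>) n) \<ge> 0"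
    by (intro sum_nonneg divide_nonneg_pos pos) simp
  have "norm (pochhammer \<delta> n) / pochhammer (Re \<delta>) n \<le> C'" for n
  proof (cases "n < N")
    case True
    then have "norm (pochhammer \<delta> n) / pochhammer (Re \<delta>) n \<le> (\<Sum>n<N. norm (pochhammer \<delta> n) / pochhammer (Re \<delta>) n)"
      using pos by (intro member_le_sum divide_nonneg_pos) auto
    then show ?thesis using K by (simp add: C'_def)
  next
    case False
    have nonpole: "\<delta> \<notin> \<int>\<^sub>\<le>\<^sub>0" "Re \<delta> \<notin> \<int>\<^sub>\<le>\<^sub>0"
      using \<delta> Re_pos_notin_nonpos_Ints nonpos_Ints_nonpos by fastforce+
    have G: "Gamma (Re \<delta> + real n) = pochhammer (Re \<delta>) n * Gamma (Re \<delta>)"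
      using pochhammer_Gamma[OF nonpole(2), of n] nonpole(2) by (simp add: Gamma_eq_zero_iff)
    have "norm (pochhammer \<delta> n) = norm (Gamma (\<delta> + of_nat n)) * norm (rGamma \<delta>)"
      using pochhammer_Gamma[OF nonpole(1), of n]
      by (simp add: norm_mult norm_inverse rGamma_inverse_Gamma norm_divide divide_inverse)
    also have "\<dots> \<le> C * Gamma (Re \<delta> + real n) * norm (rGamma \<delta>)"
      by (intro mult_right_mono bound) (use False in auto)
    also have "\<dots> = K * pochhammer (Re \<delta>) n"
      by (simp add: K_def G)
    finally have "norm (pochhammer \<delta> n) / pochhammer (Re \<delta>) n \<le> K"
      using pos[of n] by (simp add: field_simps)
    then show ?thesis using sum0 by (simp add: C'_def)
  qed
  then have "norm (pochhammer \<delta> n) \<le> C' * pochhammer (Re \<delta>) n" for n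
    by (simp only: pos_divide_le_eq[OF pos])
  moreover have "C' > 0" using K sum0 by (simp add: C'_def)
  ultimately show ?thesis by blast
qed

lemma gauss_hypergeometric_sum_real:
  fixes x y c :: real
  assumes "c - x - y > 0"
  shows "(\<lambda>k. pochhammer x k * pochhammer y k / fact k * rGamma (c + real k)) sums
           (Gamma (c - x - y) * rGamma (c - x) * rGamma (c - y))"
proof -
  have shift: "complex_of_real c + of_nat k = complex_of_real (c + real k)" for k
    by simp
  have "Re (complex_of_real c - complex_of_real x - complex_of_real y) > 0"
    using assms by simp
  from gauss_hypergeometric_sum[OF this]
  have "(\<lambda>k. complex_of_real (pochhammer x k * pochhammer y k / fact k * rGamma (c + real k))) sums
      complex_of_real (Gamma (c - x - y) * rGamma (c - x) * rGamma (c - y))"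
    by (simp only: shift of_real_diff[symmetric] pochhammer_of_real rGamma_complex_of_real
          Gamma_complex_of_real of_real_mult of_real_divide of_real_fact)
  then show ?thesis by (simp only: sums_of_real_iff)
qed

text \<open>
  Exchanging the summations reduces the claim to Gauss's theorem for each \<open>j\<close>. For the exchange, the
  sum of the moduli of row \<open>j\<close> is compared with the Gauss series formed with the real parts of the
  parameters. For large \<open>j\<close> its terms are positive because \<open>Re \<delta> > 0\<close>, and its sum is again a quotient of Gamma
  functions, comparable to the modulus of \<open>A j / \<Gamma>(u + x + j)\<close>.
\<close>

lemma coeff_step_abs_sums:
  assumes x: "Re x > 0" and \<delta>: "Re \<delta> > 0"
    and A: "abs_sums (\<lambda>j. A j * rGamma (u + x + of_nat j)) S"
  shows "abs_sums (\<lambda>k. coeff_step u \<delta> A k * rGamma (u + x + \<delta> + of_nat k)) (Gamma x * rGamma (x + \<delta>) * S)"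
proof -
  define c where "c = u + x + \<delta>"
  define t where "t = (\<lambda>j i. pochhammer (u + of_nat j) i * pochhammer \<delta> i / fact i * rGamma (c + of_nat j + of_nat i))"
  define tr where "tr = (\<lambda>j i. pochhammer (Re u + real j) i * pochhammer (Re \<delta>) i / fact i
      * rGamma (Re c + real j + real i))"
  have eqs: "c + of_nat j - (u + of_nat j) - \<delta> = x" "c + of_nat j - (u + of_nat j) = x + \<delta>"
    "c + of_nat j - \<delta> = u + x + of_nat j" for j
    by (simp_all add: c_def)
  have gauss: "abs_sums (t j) (Gamma x * rGamma (x + \<delta>) * rGamma (u + x + of_nat j))" for j
    using gauss_hypergeometric_sum[of "c + of_nat j" "u + of_nat j" \<delta>]
      gauss_summable[of "c + of_nat j" "u + of_nat j" \<delta>] x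
    unfolding eqs by (simp add: abs_sums_def t_def)
  have rows: "abs_sums (\<lambda>i. t j i * A j) (Gamma x * rGamma (x + \<delta>) * (A j * rGamma (u + x + of_nat j)))" for j
  proof -
    have "(\<lambda>i. t j i * A j) sums (Gamma x * rGamma (x + \<delta>) * rGamma (u + x + of_nat j) * A j)"
      using gauss[of j] by (intro sums_mult2) (simp add: abs_sums_def)
    moreover have "summable (\<lambda>i. norm (t j i) * norm (A j))"
      using gauss[of j] by (intro summable_mult2) (simp add: abs_sums_def)
    moreover have "Gamma x * rGamma (x + \<delta>) * rGamma (u + x + of_nat j) * A j
        = Gamma x * rGamma (x + \<delta>) * (A j * rGamma (u + x + of_nat j))"
      by (simp only: mult_ac)
    ultimately show ?thesis unfolding abs_sums_def norm_mult by (simp only: simp_thms)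
  qed
  have norms: "summable (\<lambda>j. \<Sum>i. norm (t j i * A j))"
  proof -
    obtain Cu Nu where Cu: "Cu > 0" "\<And>n. n \<ge> Nu \<Longrightarrow> Re u + real n > 0"
      "\<And>n. n \<ge> Nu \<Longrightarrow> norm (Gamma (u + of_nat n)) \<le> Cu * Gamma (Re u + real n)"
      "\<And>n. n \<ge> Nu \<Longrightarrow> norm (rGamma (u + of_nat n)) \<le> Cu * rGamma (Re u + real n)"
      using Gamma_shift_le_Gamma_Re[of u] by blast
    obtain Cc Nc where Cc: "Cc > 0"
      "\<And>n. n \<ge> Nc \<Longrightarrow> norm (rGamma (c + of_nat n)) \<le> Cc * rGamma (Re c + real n)"
      using Gamma_shift_le_Gamma_Re[of c] by blast
    obtain Cx Nx where Cx: "Cx > 0" "\<And>n. n \<ge> Nx \<Longrightarrow> Re (u + x) + real n > 0"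
      "\<And>n. n \<ge> Nx \<Longrightarrow> norm (Gamma (u + x + of_nat n)) \<le> Cx * Gamma (Re (u + x) + real n)"
      using Gamma_shift_le_Gamma_Re[of "u + x"] by blast
    obtain Cd where Cd: "Cd > 0" "\<And>n. norm (pochhammer \<delta> n) \<le> Cd * pochhammer (Re \<delta>) n"
      using norm_pochhammer_le_pochhammer_Re[OF \<delta>] by blast
    define M where "M = Cu * Cu * Cd * Cc"
    define L where "L = Gamma (Re x) * rGamma (Re x + Re \<delta>)"
    have M: "M > 0" using Cu Cc Cd by (simp add: M_def)
    have L: "L \<ge> 0"
      using x \<delta> by (simp add: L_def rGamma_inverse_Gamma Gamma_real_nonneg)
    have Re_eqs: "Re c + real j - (Re u + real j) - Re \<delta> = Re x"
      "Re c + real j - (Re u + real j) = Re x + Re \<delta>" "Re c + real j - Re \<delta> = Re (u + x) + real j" for j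
      by (simp_all add: c_def)
    have real_gauss: "tr j sums (L * rGamma (Re (u + x) + real j))" for j
      using gauss_hypergeometric_sum_real[of "Re c + real j" "Re u + real j" "Re \<delta>"] x
      unfolding Re_eqs by (simp add: tr_def L_def)
    have bound: "(\<Sum>i. norm (t j i * A j)) \<le> M * L * Cx * norm (A j * rGamma (u + x + of_nat j))"
      if j: "j \<ge> max Nu (max Nc Nx)" for j
    proof -
      have pos: "Re u + real j > 0" and pos': "Re (u + x) + real j > 0"
        using Cu(2)[of j] Cx(2)[of j] j by auto
      have nonpole: "u + of_nat j \<notin> \<int>\<^sub>\<le>\<^sub>0" "Re u + real j \<notin> \<int>\<^sub>\<le>\<^sub>0"
        using pos Re_pos_notin_nonpos_Ints[of "u + of_nat j"] nonpos_Ints_nonpos[of "Re u + real j"] by auto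
      have tt: "norm (t j i) \<le> M * tr j i" for i
      proof -
        have "norm (pochhammer (u + of_nat j) i)
            = norm (Gamma (u + of_nat (j + i))) * norm (rGamma (u + of_nat j))"
          unfolding pochhammer_Gamma[OF nonpole(1)]
          by (simp add: norm_mult rGamma_inverse_Gamma norm_inverse divide_inverse add.assoc)
        also have "\<dots> \<le> (Cu * Gamma (Re u + real (j + i))) * (Cu * rGamma (Re u + real j))"
          using j Cu(1) pos by (intro mult_mono Cu(3,4)) (auto simp: Gamma_real_nonneg add.assoc[symmetric])
        also have "\<dots> = Cu * Cu * pochhammer (Re u + real j) i"
          unfolding pochhammer_Gamma[OF nonpole(2)]
          by (simp add: rGamma_inverse_Gamma divide_inverse add.assoc)
        finally have 1: "norm (pochhammer (u + of_nat j) i) \<le> Cu * Cu * pochhammer (Re u + real j) i" .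
        have 2: "norm (rGamma (c + of_nat j + of_nat i)) \<le> Cc * rGamma (Re c + real j + real i)"
          using Cc(2)[of "j + i"] j by (simp add: add.assoc)
        have "norm (pochhammer (u + of_nat j) i) * norm (pochhammer \<delta> i) * norm (rGamma (c + of_nat j + of_nat i))
            \<le> (Cu * Cu * pochhammer (Re u + real j) i) * (Cd * pochhammer (Re \<delta>) i) * (Cc * rGamma (Re c + real j + real i))"
          using 1 2 Cd(2)[of i] Cu(1) Cd(1) pos \<delta>
          by (intro mult_mono) (auto intro!: mult_nonneg_nonneg pochhammer_nonneg)
        then have "norm (pochhammer (u + of_nat j) i) * norm (pochhammer \<delta> i) * norm (rGamma (c + of_nat j + of_nat i)) / fact i
            \<le> (Cu * Cu * pochhammer (Re u + real j) i) * (Cd * pochhammer (Re \<delta>) i) * (Cc * rGamma (Re c + real j + real i)) / fact i"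
          by (rule divide_right_mono) simp
        then show ?thesis
          by (simp add: t_def tr_def M_def norm_mult norm_divide mult_ac)
      qed
      have "(\<Sum>i. norm (t j i * A j)) \<le> (\<Sum>i. M * tr j i * norm (A j))"
      proof (rule suminf_le)
        show "norm (t j i * A j) \<le> M * tr j i * norm (A j)" for i
          using mult_right_mono[OF tt[of i], of "norm (A j)"] by (simp add: norm_mult)
        show "summable (\<lambda>i. norm (t j i * A j))"
          using rows[of j] by (simp add: abs_sums_def)
        show "summable (\<lambda>i. M * tr j i * norm (A j))"
          using real_gauss[of j] by (intro summable_mult2 summable_mult) (simp add: sums_iff)
      qed
      also have "\<dots> = M * (L * rGamma (Re (u + x) + real j)) * norm (A j)"
        by (intro sums_unique[symmetric] sums_mult2 sums_mult real_gauss)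
      also have "\<dots> \<le> M * (L * (Cx * norm (rGamma (u + x + of_nat j)))) * norm (A j)"
      proof (intro mult_right_mono mult_left_mono)
        have g: "Gamma (Re (u + x) + real j) > 0" using pos' by (rule Gamma_real_pos)
        have "u + x + of_nat j \<notin> \<int>\<^sub>\<le>\<^sub>0"
          using pos' by (intro Re_pos_notin_nonpos_Ints) simp
        then have "norm (Gamma (u + x + of_nat j)) > 0" by (simp add: Gamma_eq_zero_iff)
        then show "rGamma (Re (u + x) + real j) \<le> Cx * norm (rGamma (u + x + of_nat j))"
          using Cx(3)[of j] j g by (simp add: rGamma_inverse_Gamma norm_inverse norm_divide divide_simps mult_ac)
      qed (use M L in auto)
      also have "\<dots> = M * L * Cx * norm (A j * rGamma (u + x + of_nat j))"
        by (simp add: norm_mult)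
      finally show ?thesis .
    qed
    show ?thesis
    proof (rule summable_comparison_test')
      show "summable (\<lambda>j. M * L * Cx * norm (A j * rGamma (u + x + of_nat j)))"
        using A by (intro summable_mult) (simp add: abs_sums_def)
      show "norm (\<Sum>i. norm (t j i * A j)) \<le> M * L * Cx * norm (A j * rGamma (u + x + of_nat j))"
        if "j \<ge> max Nu (max Nc Nx)" for j
        using bound[OF that] rows[of j] by (simp add: suminf_nonneg abs_sums_def)
    qed
  qed
  have "abs_sums (\<lambda>k. \<Sum>j=0..k. t j (k - j) * A j)
      (\<Sum>j. Gamma x * rGamma (x + \<delta>) * (A j * rGamma (u + x + of_nat j)))"
    by (rule abs_sums_triangle[OF rows norms])
  moreover have "(\<Sum>j. Gamma x * rGamma (x + \<delta>) * (A j * rGamma (u + x + of_nat j))) = Gamma x * rGamma (x + \<delta>) * S"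
    using A by (intro sums_unique[symmetric] sums_mult) (simp add: abs_sums_def)
  moreover have "(\<Sum>j=0..k. t j (k - j) * A j) = coeff_step u \<delta> A k * rGamma (u + x + \<delta> + of_nat k)" for k
    unfolding coeff_step_def sum_distrib_right
    by (intro sum.cong refl) (simp add: t_def c_def of_nat_diff mult_ac add_ac)
  ultimately show ?thesis by simp
qed

text \<open>
  The parameter \<open>v\<close> plays the part of \<open>a\<^sub>4\<close>, and \<open>x\<close> that of \<open>a\<^sub>3\<close>. By \<open>coeff_step_exchange\<close> the case \<open>\<delta>\<close>
  follows from the case \<open>\<delta> + 1\<close> for \<open>v\<close> and for \<open>v + 1\<close>, so the condition on \<open>\<delta>\<close> in
  \<open>coeff_step_abs_sums\<close> can be removed by induction on an integer \<open>n\<close> with \<open>Re \<delta> + n > 0\<close>.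
\<close>

lemma coeff_step_family_abs_sums:
  fixes A :: "complex \<Rightarrow> nat \<Rightarrow> complex"
  assumes x: "Re x > 0"
    and A0: "\<And>v. A (v + 1) 0 = A v 0"
    and ASuc: "\<And>v j. A (v + 1) (Suc j) = A v (Suc j) - (D - 2 * v + of_nat j - 1) * A v j"
    and sums: "\<And>v. Re v > 0 \<Longrightarrow> abs_sums (\<lambda>j. A v j * rGamma (D - v + of_nat j)) (Gamma v * R)"
    and v: "Re v > 0"
  shows "abs_sums (\<lambda>k. coeff_step (D - v - x) \<delta> (A v) k * rGamma (D - v + \<delta> + of_nat k))
           (Gamma x * rGamma (x + \<delta>) * (Gamma v * R))"
proof -
  obtain n :: nat where "- Re \<delta> < real n"
    using reals_Archimedean2 by blast
  then have "Re \<delta> + real n > 0" by linarith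
  then show ?thesis using v
  proof (induction n arbitrary: v \<delta>)
    case 0
    have "abs_sums (\<lambda>j. A v j * rGamma (D - v - x + x + of_nat j)) (Gamma v * R)"
      using sums[OF 0(2)] by simp
    from coeff_step_abs_sums[OF x _ this, of \<delta>] 0 show ?case by simp
  next
    case (Suc n)
    define P where "P = (\<lambda>k. coeff_step (D - (v + 1) - x) (\<delta> + 1) (A (v + 1)) k
      * rGamma (D - (v + 1) + (\<delta> + 1) + of_nat k))"
    define Q where "Q = (\<lambda>k. coeff_step (D - v - x) (\<delta> + 1) (A v) k * rGamma (D - v + (\<delta> + 1) + of_nat k))"
    have "abs_sums P (Gamma x * rGamma (x + (\<delta> + 1)) * (Gamma (v + 1) * R))"
      unfolding P_def by (rule Suc.IH) (use Suc.prems in auto)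
    moreover have "abs_sums Q (Gamma x * rGamma (x + (\<delta> + 1)) * (Gamma v * R))"
      unfolding Q_def by (rule Suc.IH) (use Suc.prems in auto)
    ultimately have PQ: "abs_sums (\<lambda>k. P k + (\<delta> + x - v) * (case k of 0 \<Rightarrow> 0 | Suc k \<Rightarrow> Q k))
        (Gamma x * rGamma (x + (\<delta> + 1)) * (Gamma (v + 1) * R)
          + (\<delta> + x - v) * (Gamma x * rGamma (x + (\<delta> + 1)) * (Gamma v * R)))"
      by (intro abs_sums_add abs_sums_cmult abs_sums_Suc)
    have split: "P k + (\<delta> + x - v) * (case k of 0 \<Rightarrow> 0 | Suc k \<Rightarrow> Q k)
        = coeff_step (D - v - x) \<delta> (A v) k * rGamma (D - v + \<delta> + of_nat k)" for k
    proof (cases k)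
      case 0
      show ?thesis
        unfolding 0 P_def coeff_step_0 A0 by (simp add: algebra_simps)
    next
      case (Suc k')
      have "A (v + 1) (Suc j) = A v (Suc j) - (D - v - x + of_nat j - 1 + (x - v)) * A v j" for j
        unfolding ASuc by (simp add: algebra_simps)
      from coeff_step_exchange[of "A (v + 1)" "A v" "D - v - x" "x - v" \<delta> k', OF A0 this]
      have "coeff_step (D - v - x) \<delta> (A v) (Suc k')
          = coeff_step (D - v - x - 1) (\<delta> + 1) (A (v + 1)) (Suc k')
            + (\<delta> + x - v) * coeff_step (D - v - x) (\<delta> + 1) (A v) k'"
        by (simp only: add_diff_eq)
      moreover have "D - (v + 1) - x = D - v - x - 1" "D - (v + 1) + (\<delta> + 1) + of_nat (Suc k') = D - v + \<delta> + of_nat (Suc k')"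
        "D - v + (\<delta> + 1) + of_nat k' = D - v + \<delta> + of_nat (Suc k')"
        by simp_all
      ultimately show ?thesis
        unfolding Suc P_def Q_def nat.case by (simp only: distrib_right mult.assoc)
    qed
    have "v \<notin> \<int>\<^sub>\<le>\<^sub>0" using Suc.prems(2) by (rule Re_pos_notin_nonpos_Ints)
    then have "Gamma (v + 1) = v * Gamma v" by (rule Gamma_plus1)
    moreover have "rGamma (x + \<delta>) = (x + \<delta>) * rGamma (x + (\<delta> + 1))"
      using rGamma_plus1[of "x + \<delta>"] by (simp add: add.assoc)
    ultimately have "Gamma x * rGamma (x + (\<delta> + 1)) * (Gamma (v + 1) * R)
          + (\<delta> + x - v) * (Gamma x * rGamma (x + (\<delta> + 1)) * (Gamma v * R))
        = Gamma x * rGamma (x + \<delta>) * (Gamma v * R)"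
      by (simp add: algebra_simps)
    with PQ show ?case unfolding split by (simp only:)
  qed
qed

section \<open>The coefficients as those of an inverse factorial series\<close>

lemma coeff_A_Suc_Suc:
  "coeff_A (Suc (Suc q)) a b
     = coeff_step ((\<Sum>i=2..Suc (Suc q). b i) - (\<Sum>i=3..Suc (Suc (Suc q)). a i)) (b 1 - a 3)
         (coeff_A (Suc q) (\<lambda>i. a (i + 1)) (\<lambda>i. b (i + 1)))"
  by (rule ext) (simp add: coeff_step_def Let_def)

declare coeff_A.simps(2) [simp del]

lemma coeff_A_cong:
  assumes "\<And>i. i \<in> {3..Suc (Suc q)} \<Longrightarrow> a i = a' i" and "\<And>i. i \<in> {1..Suc q} \<Longrightarrow> b i = b' i"
  shows "coeff_A (Suc q) a b = coeff_A (Suc q) a' b'"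
  using assms
proof (induction q arbitrary: a a' b b')
  case 0
  show ?case by (rule ext) simp
next
  case (Suc q)
  have "coeff_A (Suc q) (\<lambda>i. a (i + 1)) (\<lambda>i. b (i + 1)) = coeff_A (Suc q) (\<lambda>i. a' (i + 1)) (\<lambda>i. b' (i + 1))"
    by (rule Suc.IH) (use Suc.prems in auto)
  moreover have "(\<Sum>i=2..Suc (Suc q). b i) = (\<Sum>i=2..Suc (Suc q). b' i)"
    "(\<Sum>i=3..Suc (Suc (Suc q)). a i) = (\<Sum>i=3..Suc (Suc (Suc q)). a' i)"
    by (intro sum.cong refl Suc.prems; simp)+
  moreover have "b 1 = b' 1" "a 3 = a' 3" using Suc.prems by auto
  ultimately show ?case by (simp only: coeff_A_Suc_Suc)
qed

text \<open>
  The recursion involves only differences of parameters, as many \<open>a\<^sub>i\<close> as \<open>b\<^sub>i\<close> in each sum. Hence one set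
  of coefficients serves all the summands \<open>l\<close>.
\<close>

lemma coeff_A_translate:
  "coeff_A (Suc q) (\<lambda>i. a i + t) (\<lambda>i. b i + t) = coeff_A (Suc q) a b"
proof (induction q arbitrary: a b)
  case 0
  show ?case by (rule ext) simp
next
  case (Suc q)
  have "(\<Sum>i=2..Suc (Suc q). b i + t) - (\<Sum>i=3..Suc (Suc (Suc q)). a i + t)
      = (\<Sum>i=2..Suc (Suc q). b i) - (\<Sum>i=3..Suc (Suc (Suc q)). a i)"
    by (simp add: sum.distrib del: sum.cl_ivl_Suc)
  then show ?case
    by (simp only: coeff_A_Suc_Suc Suc.IH) simp
qed

text \<open>
  Induction along the recursion. For \<open>p = 2\<close> the series is Gauss's. For \<open>p \<ge> 3\<close> the inner coefficients
  form, as functions of their first upper parameter \<open>v\<close>, a family to which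
  \<open>coeff_step_family_abs_sums\<close> applies: \<open>coeff_step_raise\<close> provides the relation between \<open>v\<close> and
  \<open>v + 1\<close>, and the induction hypothesis the sum for every \<open>v\<close> with positive real part.
\<close>

lemma coeff_A_abs_sums:
  assumes "\<And>j. j \<in> {3..Suc (Suc q)} \<Longrightarrow> Re (a j) > 0"
  shows "abs_sums (\<lambda>k. coeff_A (Suc q) a b k
           * rGamma ((\<Sum>i=1..Suc q. b i) - (\<Sum>i=3..Suc (Suc q). a i) + of_nat k))
         ((\<Prod>j=3..Suc (Suc q). Gamma (a j)) * (\<Prod>j=1..Suc q. rGamma (b j)))"
  using assms
proof (induction q arbitrary: a b)
  case 0
  have "(\<lambda>k. coeff_A (Suc 0) a b k * rGamma (b 1 + of_nat k)) = (\<lambda>k. if k = 0 then rGamma (b 1) else 0)"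
    by auto
  moreover have "abs_sums (\<lambda>k. if k = 0 then rGamma (b 1) else 0) (rGamma (b 1))"
    using sums_single[of 0 "\<lambda>_. rGamma (b 1)"] sums_single[of 0 "\<lambda>_. norm (rGamma (b 1))"]
    by (simp add: abs_sums_def if_distrib[of norm] sums_iff cong: if_cong)
  ultimately show ?case by simp
next
  case (Suc q)
  show ?case
  proof (cases q)
    case 0
    have "{1..Suc (Suc 0)} = {1, 2 :: nat}" "{3..Suc (Suc (Suc 0))} = {3 :: nat}"
      "{2..Suc (Suc 0)} = {2 :: nat}" by auto
    note sets = this
    have "coeff_A (Suc (Suc 0)) a b k = pochhammer (b 2 - a 3) k * pochhammer (b 1 - a 3) k / fact k" for k
      unfolding coeff_A_Suc_Suc sets coeff_step_def
      by (simp add: if_distrib sum.delta cong: if_cong)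
    moreover have "b 1 + b 2 - a 3 - (b 2 - a 3) - (b 1 - a 3) = a 3"
      "b 1 + b 2 - a 3 - (b 2 - a 3) = b 1" "b 1 + b 2 - a 3 - (b 1 - a 3) = b 2" by simp_all
    moreover have "Re (a 3) > 0" using Suc.prems 0 by simp
    ultimately show ?thesis
      using gauss_hypergeometric_sum[of "b 1 + b 2 - a 3" "b 2 - a 3" "b 1 - a 3"]
        gauss_summable[of "b 1 + b 2 - a 3" "b 2 - a 3" "b 1 - a 3"]
      unfolding 0 sets by (simp add: abs_sums_def mult.assoc)
  next
    case (Suc r)
    define b' where "b' = (\<lambda>i. b (i + 1))"
    define a' where "a' = (\<lambda>v. (\<lambda>i. a (i + 1))(3 := v))"
    define A where "A = (\<lambda>v. coeff_A (Suc (Suc r)) (a' v) b')"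
    define D where "D = (\<Sum>i=1..Suc (Suc r). b' i) - (\<Sum>i=4..Suc (Suc (Suc r)). a (i + 1))"
    define R where "R = (\<Prod>j=4..Suc (Suc (Suc r)). Gamma (a (j + 1))) * (\<Prod>j=1..Suc (Suc r). rGamma (b' j))"
    \<comment> \<open>The inner coefficients are one step, depending on \<open>v\<close> only through \<open>U - v\<close> and \<open>b\<^sub>2 - v\<close>, applied to a sequence \<open>B\<close> independent of \<open>v\<close>.\<close>
    define U where "U = (\<Sum>i=2..Suc (Suc r). b' i) - (\<Sum>i=4..Suc (Suc (Suc r)). a (i + 1))"
    define B where "B = coeff_A (Suc r) (\<lambda>i. a (i + 1 + 1)) (\<lambda>i. b' (i + 1))"
    have set3: "{3..Suc (Suc (Suc r))} = insert 3 {4..Suc (Suc (Suc r))}" by auto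
    have set1: "{1..Suc (Suc r)} = insert 1 {2..Suc (Suc r)}" by auto
    have sum_a': "(\<Sum>i=3..Suc (Suc (Suc r)). a' v i) = v + (\<Sum>i=4..Suc (Suc (Suc r)). a (i + 1))" for v
    proof -
      have "(\<Sum>i=4..Suc (Suc (Suc r)). a' v i) = (\<Sum>i=4..Suc (Suc (Suc r)). a (i + 1))"
        by (intro sum.cong) (auto simp: a'_def)
      then show ?thesis unfolding set3 by (subst sum.insert) (auto simp: a'_def)
    qed
    have prod_a': "(\<Prod>j=3..Suc (Suc (Suc r)). Gamma (a' v j))
        = Gamma v * (\<Prod>j=4..Suc (Suc (Suc r)). Gamma (a (j + 1)))" for v
    proof -
      have "(\<Prod>j=4..Suc (Suc (Suc r)). Gamma (a' v j)) = (\<Prod>j=4..Suc (Suc (Suc r)). Gamma (a (j + 1)))"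
        by (intro prod.cong) (auto simp: a'_def)
      then show ?thesis unfolding set3 by (subst prod.insert) (auto simp: a'_def)
    qed
    have A: "A v = coeff_step (U - v) (b' 1 - v) B" for v
    proof -
      have "coeff_A (Suc r) (\<lambda>i. a' v (i + 1)) (\<lambda>i. b' (i + 1)) = B"
        unfolding B_def by (rule coeff_A_cong) (auto simp: a'_def)
      moreover have "(\<Sum>i=2..Suc (Suc r). b' i) - (\<Sum>i=3..Suc (Suc (Suc r)). a' v i) = U - v"
        unfolding sum_a' by (simp add: U_def)
      moreover have "a' v 3 = v" by (simp add: a'_def)
      ultimately show ?thesis unfolding A_def coeff_A_Suc_Suc by (simp only:)
    qed
    have D: "D = U + b' 1"
      unfolding D_def U_def set1 by (subst sum.insert) auto
    have A_Suc: "A (v + 1) (Suc j) = A v (Suc j) - (D - 2 * v + of_nat j - 1) * A v j" for v j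
    proof -
      have "U - (v + 1) = U - v - 1" "b' 1 - (v + 1) = b' 1 - v - 1"
        "D - 2 * v + of_nat j - 1 = U - v + (b' 1 - v) + of_nat j - 1"
        by (simp_all add: D)
      then show ?thesis unfolding A using coeff_step_raise[of "U - v" "b' 1 - v" B j] by (simp only:)
    qed
    have A_sums: "abs_sums (\<lambda>j. A v j * rGamma (D - v + of_nat j)) (Gamma v * R)" if "Re v > 0" for v
    proof -
      have "abs_sums (\<lambda>k. coeff_A (Suc (Suc r)) (a' v) b' k
           * rGamma ((\<Sum>i=1..Suc (Suc r). b' i) - (\<Sum>i=3..Suc (Suc (Suc r)). a' v i) + of_nat k))
         ((\<Prod>j=3..Suc (Suc (Suc r)). Gamma (a' v j)) * (\<Prod>j=1..Suc (Suc r). rGamma (b' j)))"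
        unfolding Suc[symmetric]
      proof (rule Suc.IH)
        show "Re (a' v j) > 0" if "j \<in> {3..Suc (Suc q)}" for j
          using that \<open>Re v > 0\<close> Suc.prems[of "j + 1"] by (auto simp: a'_def)
      qed
      moreover have "(\<Sum>i=1..Suc (Suc r). b' i) - (\<Sum>i=3..Suc (Suc (Suc r)). a' v i) = D - v"
        unfolding sum_a' by (simp add: D_def)
      ultimately show ?thesis
        unfolding prod_a' A_def R_def by (simp only: mult.assoc)
    qed
    have "abs_sums (\<lambda>k. coeff_step (D - a 4 - a 3) (b 1 - a 3) (A (a 4)) k
            * rGamma (D - a 4 + (b 1 - a 3) + of_nat k))
         (Gamma (a 3) * rGamma (a 3 + (b 1 - a 3)) * (Gamma (a 4) * R))"
    proof (rule coeff_step_family_abs_sums[OF _ _ A_Suc A_sums])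
      show "A (v + 1) 0 = A v 0" for v by (simp add: A)
      show "Re (a 3) > 0" "Re (a 4) > 0" using Suc.prems \<open>q = Suc r\<close> by auto
    qed
    moreover have "A (a 4) = coeff_A (Suc (Suc r)) (\<lambda>i. a (i + 1)) (\<lambda>i. b (i + 1))"
      unfolding A_def b'_def by (rule coeff_A_cong) (auto simp: a'_def)
    moreover have sb: "(\<Sum>i=1..Suc (Suc r). b' i) = (\<Sum>i=2..Suc (Suc (Suc r)). b i)"
      using sum.shift_bounds_cl_nat_ivl[of b 1 1 "Suc (Suc r)"] by (simp add: b'_def numeral_2_eq_2 del: sum.cl_ivl_Suc)
    moreover have sa: "(\<Sum>i=4..Suc (Suc (Suc r)). a (i + 1)) = (\<Sum>i=5..Suc (Suc (Suc (Suc r))). a i)"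
      using sum.shift_bounds_cl_nat_ivl[of a 4 1 "Suc (Suc (Suc r))"] by (simp del: sum.cl_ivl_Suc)
    moreover have seta: "{3..Suc (Suc (Suc (Suc r)))} = insert 3 (insert 4 {5..Suc (Suc (Suc (Suc r)))})"
      and setb: "{1..Suc (Suc (Suc r))} = insert 1 {2..Suc (Suc (Suc r))}" by auto
    moreover have sa3: "(\<Sum>i=3..Suc (Suc (Suc (Suc r))). a i) = a 3 + (a 4 + (\<Sum>i=5..Suc (Suc (Suc (Suc r))). a i))"
      unfolding seta by (simp del: sum.cl_ivl_Suc)
    moreover have sb1: "(\<Sum>i=1..Suc (Suc (Suc r)). b i) = b 1 + (\<Sum>i=2..Suc (Suc (Suc r)). b i)"
      unfolding setb by (simp del: sum.cl_ivl_Suc)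
    moreover have u: "D - a 4 - a 3 = (\<Sum>i=2..Suc (Suc (Suc r)). b i) - (\<Sum>i=3..Suc (Suc (Suc (Suc r))). a i)"
      unfolding D_def sb sa sa3 by simp
    moreover have "D - a 4 + (b 1 - a 3) = (\<Sum>i=1..Suc (Suc (Suc r)). b i) - (\<Sum>i=3..Suc (Suc (Suc (Suc r))). a i)"
      unfolding D_def sb sa sa3 sb1 by simp
    moreover have "Gamma (a 3) * rGamma (a 3 + (b 1 - a 3)) * (Gamma (a 4) * R)
        = (\<Prod>j=3..Suc (Suc (Suc (Suc r))). Gamma (a j)) * (\<Prod>j=1..Suc (Suc (Suc r)). rGamma (b j))"
    proof -
      have "(\<Prod>j=1..Suc (Suc r). rGamma (b' j)) = (\<Prod>j=2..Suc (Suc (Suc r)). rGamma (b j))"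
        using prod.shift_bounds_cl_nat_ivl[of "\<lambda>j. rGamma (b j)" 1 1 "Suc (Suc r)"]
        by (simp add: b'_def numeral_2_eq_2 del: prod.cl_ivl_Suc)
      moreover have "(\<Prod>j=4..Suc (Suc (Suc r)). Gamma (a (j + 1))) = (\<Prod>j=5..Suc (Suc (Suc (Suc r))). Gamma (a j))"
        using prod.shift_bounds_cl_nat_ivl[of "\<lambda>j. Gamma (a j)" 4 1 "Suc (Suc (Suc r))"]
        by (simp del: prod.cl_ivl_Suc)
      ultimately show ?thesis
        unfolding R_def seta setb by (simp add: mult_ac del: prod.cl_ivl_Suc)
    qed
    ultimately show ?thesis
      unfolding \<open>q = Suc r\<close> coeff_A_Suc_Suc by (simp only:)
  qed
qed

section \<open>Partial sums of the general series\<close>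

lemma sum_triangle_swap:
  "(\<Sum>n=0..N. \<Sum>k=0..n. X n k) = (\<Sum>k<Suc N. \<Sum>i<Suc N - k. X (i + k) k)"
  for X :: "nat \<Rightarrow> nat \<Rightarrow> complex"
proof -
  have "(\<Sum>n=0..N. \<Sum>k=0..n. X n k) = (\<Sum>(n, k)\<in>(SIGMA n:{0..N}. {0..n}). X n k)"
    by (simp add: sum.Sigma)
  also have "\<dots> = (\<Sum>(k, i)\<in>(SIGMA k:{..<Suc N}. {..<Suc N - k}). X (i + k) k)"
    by (rule sum.reindex_bij_witness[of _ "\<lambda>(k, i). (i + k, k)" "\<lambda>(n, k). (k, n - k)"]) auto
  also have "\<dots> = (\<Sum>k<Suc N. \<Sum>i<Suc N - k. X (i + k) k)"
    by (simp add: sum.Sigma del: sum.lessThan_Suc)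
  finally show ?thesis .
qed

text \<open>
  Grouping by \<open>k\<close> shows the expansion as a combination of the expansions of the partial sums of Gauss's
  series with \<open>s\<close> replaced by \<open>s + k\<close>.
\<close>

lemma expansion_sum_eq:
  fixes a b :: "nat \<Rightarrow> complex" and p N m :: nat
  defines "s \<equiv> param_s p a b"
  shows "expansion_sum p a b N m = (\<Sum>k<Suc N. coeff_A p a b k
     * (\<Sum>n<Suc N - k. quotient_coeff (a 2 + s + of_nat k) (a 1 + s + of_nat k) n / (s + of_nat k + of_nat n)
          * (Gamma (of_nat m - (s + of_nat k) - of_nat n) * rGamma (of_nat m))))"
proof -
  define X where "X = (\<lambda>n k. (-1) ^ n * (1 / (s + of_nat n)) * (1 / pochhammer 1 n)
        * (Gamma (- s - of_nat n + of_nat m) / Gamma (of_nat m))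
        * (pochhammer (- of_nat n) k * pochhammer (a 1 + s + of_nat k) (n - k)
              * pochhammer (a 2 + s + of_nat k) (n - k) * coeff_A p a b k))"
  have "expansion_sum p a b N m = (\<Sum>n=0..N. \<Sum>k=0..n. X n k)"
    unfolding expansion_sum_def Let_def s_def[symmetric] X_def sum_distrib_left ..
  also have "\<dots> = (\<Sum>k<Suc N. \<Sum>i<Suc N - k. X (i + k) k)"
    by (rule sum_triangle_swap)
  also have "\<dots> = (\<Sum>k<Suc N. coeff_A p a b k
     * (\<Sum>n<Suc N - k. quotient_coeff (a 2 + s + of_nat k) (a 1 + s + of_nat k) n / (s + of_nat k + of_nat n)
          * (Gamma (of_nat m - (s + of_nat k) - of_nat n) * rGamma (of_nat m))))"
    unfolding sum_distrib_left
  proof (intro sum.cong refl)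
    fix k i
    define P where "P = pochhammer (1 + of_nat i :: complex) k"
    have P: "P \<noteq> 0"
      unfolding P_def using pochhammer_eq_0_imp_nonpos_Int Re_pos_notin_nonpos_Ints[of "1 + of_nat i"] by auto
    have "pochhammer (- of_nat (i + k)) k = (-1) ^ k * P"
      unfolding P_def pochhammer_minus by (simp add: add_ac)
    moreover have "pochhammer 1 (i + k) = fact i * P"
      unfolding P_def pochhammer_product' by (simp add: pochhammer_fact)
    ultimately have coeff: "(-1) ^ (i + k) * pochhammer (- of_nat (i + k)) k / pochhammer 1 (i + k) = (-1) ^ i / (fact i :: complex)"
      using P by (simp add: power_add power_mult_distrib[symmetric] mult_ac)
    have "X (i + k) k = ((-1) ^ (i + k) * pochhammer (- of_nat (i + k)) k / pochhammer 1 (i + k))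
        * (1 / (s + of_nat (i + k))) * (Gamma (- s - of_nat (i + k) + of_nat m) / Gamma (of_nat m))
        * (pochhammer (a 1 + s + of_nat k) i * pochhammer (a 2 + s + of_nat k) i * coeff_A p a b k)"
      unfolding X_def by (simp only: add_diff_cancel_right' divide_inverse mult_1_left mult_ac)
    also have "\<dots> = coeff_A p a b k * (quotient_coeff (a 2 + s + of_nat k) (a 1 + s + of_nat k) i / (s + of_nat k + of_nat i)
          * (Gamma (of_nat m - (s + of_nat k) - of_nat i) * rGamma (of_nat m)))"
      unfolding coeff quotient_coeff_def by (simp add: rGamma_inverse_Gamma divide_inverse algebra_simps)
    finally show "X (i + k) k = coeff_A p a b k * (quotient_coeff (a 2 + s + of_nat k) (a 1 + s + of_nat k) i / (s + of_nat k + of_nat i)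
          * (Gamma (of_nat m - (s + of_nat k) - of_nat i) * rGamma (of_nat m)))" .
  qed
  finally show ?thesis .
qed

theorem theorem3:
  fixes p N :: nat and a b :: "nat \<Rightarrow> complex"
  assumes "p \<ge> 1"
    and "\<And>j. j \<in> {1..p+1} \<Longrightarrow> a j \<notin> \<int>\<^sub>\<le>\<^sub>0"
    and "\<And>j. j \<in> {3..p+1} \<Longrightarrow> Re (a j) > 0"
    and "param_s p a b \<notin> \<int>"
    and "real N > Re (- param_s p a b)"
  shows "summable (g0_term p a b) \<and>
    (\<lambda>m::nat. hyp_partial_sum p a b m - (g0 p a b - expansion_sum p a b N m))
      \<in> O(\<lambda>m. of_nat m powr (- param_s p a b - of_nat N - 1))"
proof -
  obtain q where p: "p = Suc q" using assms(1) by (cases p) auto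
  define s where "s = param_s p a b"
  define x y c where "x = a 1" and "y = a 2" and "c = x + y + s"
  define A where "A = coeff_A p a b"
  have x: "x \<notin> \<int>\<^sub>\<le>\<^sub>0" and y: "y \<notin> \<int>\<^sub>\<le>\<^sub>0"
    using assms(1) assms(2)[of 1] assms(2)[of 2] by (auto simp: x_def y_def)
  have s: "s \<notin> \<int>" and sN: "Re s + real N > 0" using assms(4,5) by (auto simp: s_def)
  have set: "{1..Suc (Suc q)} = insert 1 (insert 2 {3..Suc (Suc q)})" by auto
  have c: "c = (\<Sum>i=1..Suc q. b i) - (\<Sum>i=3..Suc (Suc q). a i)"
  proof -
    have "(\<Sum>i=1..Suc (Suc q). a i) = a 1 + (a 2 + (\<Sum>i=3..Suc (Suc q). a i))"
      unfolding set by (subst sum.insert, simp, simp, subst sum.insert) simp_all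
    then show ?thesis
      unfolding c_def x_def y_def s_def param_s_def p Suc_eq_plus1[symmetric] by (simp only:) (simp only: algebra_simps)
  qed
  define h where "h = (\<lambda>l. Gamma (x + of_nat l) * Gamma (y + of_nat l) * rGamma (1 + of_nat l))"
  define u where "u = (\<lambda>l. h l * ((\<Prod>j=3..Suc (Suc q). Gamma (a j + of_nat l)) * (\<Prod>j=1..Suc q. rGamma (b j + of_nat l))))"
  have hyp: "hyp_partial_sum p a b m = (\<Sum>l<m. u l)" for m
    unfolding hyp_partial_sum_def
  proof (intro sum.cong refl)
    fix l
    show "(\<Prod>j=1..p+1. Gamma (a j + of_nat l)) * (\<Prod>j=1..p. rGamma (b j + of_nat l)) * rGamma (1 + of_nat l) = u l"
    proof -
      have "(\<Prod>j=1..Suc (Suc q). Gamma (a j + of_nat l))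
          = Gamma (x + of_nat l) * (Gamma (y + of_nat l) * (\<Prod>j=3..Suc (Suc q). Gamma (a j + of_nat l)))"
        unfolding set x_def y_def by (subst prod.insert, simp, simp, subst prod.insert) simp_all
      then show ?thesis
        unfolding p Suc_eq_plus1[symmetric] u_def h_def by (simp only: mult_ac)
    qed
  qed
  have A_sums: "abs_sums (\<lambda>k. A k * rGamma (c + of_nat l + of_nat k))
      ((\<Prod>j=3..Suc (Suc q). Gamma (a j + of_nat l)) * (\<Prod>j=1..Suc q. rGamma (b j + of_nat l)))" for l
  proof -
    have "abs_sums (\<lambda>k. coeff_A (Suc q) (\<lambda>i. a i + of_nat l) (\<lambda>i. b i + of_nat l) k
           * rGamma ((\<Sum>i=1..Suc q. b i + of_nat l) - (\<Sum>i=3..Suc (Suc q). a i + of_nat l) + of_nat k))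
         ((\<Prod>j=3..Suc (Suc q). Gamma (a j + of_nat l)) * (\<Prod>j=1..Suc q. rGamma (b j + of_nat l)))"
    proof (rule coeff_A_abs_sums)
      show "Re (a j + of_nat l) > 0" if "j \<in> {3..Suc (Suc q)}" for j
        using assms(3)[of j] that by (simp add: p add_pos_nonneg)
    qed
    moreover have "(\<Sum>i=1..Suc q. b i + of_nat l) - (\<Sum>i=3..Suc (Suc q). a i + of_nat l) = c + of_nat l"
      unfolding c by (simp add: sum.distrib algebra_simps del: sum.cl_ivl_Suc)
    ultimately show ?thesis
      unfolding coeff_A_translate A_def p by (simp only:)
  qed
  have u_sums: "abs_sums (\<lambda>k. h l * (A k * rGamma (c + of_nat l + of_nat k))) (u l)" for l
    using abs_sums_cmult[OF A_sums[of l], of "h l"] unfolding u_def .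
  define C where "C = (\<lambda>k. Gamma x * Gamma y * (Gamma (s + of_nat k) * rGamma (y + s + of_nat k) * rGamma (x + s + of_nat k)))"
  have C_g0: "A k * C k = Gamma x * Gamma y * Gamma s * g0_term p a b k" for k
  proof -
    have "s \<notin> \<int>\<^sub>\<le>\<^sub>0" using s nonpos_Ints_Int by blast
    then have "Gamma (s + of_nat k) = Gamma s * pochhammer s k"
      by (simp add: pochhammer_Gamma Gamma_eq_zero_iff)
    then show ?thesis
      unfolding C_def g0_term_def Let_def s_def[symmetric] A_def x_def y_def by (simp only: mult_ac)
  qed
  have eqs: "c + of_nat k - x = y + s + of_nat k" "y + s + of_nat k - y = s + of_nat k"
    "c + of_nat k - y = x + s + of_nat k" for k
    by (simp_all add: c_def)
  have h_poch: "h l * rGamma (c + of_nat l + of_nat k)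
      = Gamma x * Gamma y * (pochhammer x l * pochhammer y l / fact l * rGamma (c + of_nat k + of_nat l))" for l k
    using x y by (simp add: h_def pochhammer_Gamma Gamma_eq_zero_iff rGamma_one_plus_nat add_ac)
  \<comment> \<open>The part of the double series with \<open>k > N\<close>, where \<open>k = i + N + 1\<close>; its row sums are \<open>T\<close>. The modulus of a row is governed by the factor \<open>e l\<close>, since from \<open>l0\<close> on the moduli of the remaining factors decrease in \<open>l\<close>.\<close>
  define f where "f = (\<lambda>l i. h l * (A (i + Suc N) * rGamma (c + of_nat l + of_nat (i + Suc N))))"
  define T where "T = (\<lambda>l. u l - (\<Sum>k<Suc N. h l * (A k * rGamma (c + of_nat l + of_nat k))))"
  define e where "e = (\<lambda>l. h l * rGamma (c + of_nat (Suc N) + of_nat l))"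
  have rows: "abs_sums (f l) (T l)" for l
    unfolding f_def T_def by (rule abs_sums_split_initial[OF u_sums])
  have columns: "(\<lambda>l. f l i) sums (A (i + Suc N) * C (i + Suc N))" for i
  proof -
    define k where "k = i + Suc N"
    have "Re (c + of_nat k - x - y) > 0" unfolding eqs using sN by (simp add: k_def)
    from sums_mult[OF gauss_hypergeometric_sum[OF this], of "A k * (Gamma x * Gamma y)"]
    have "(\<lambda>l. A k * (h l * rGamma (c + of_nat l + of_nat k))) sums (A k * C k)"
      unfolding eqs C_def h_poch by (simp only: mult.assoc)
    then show ?thesis by (simp only: f_def k_def mult.left_commute[of "A _"])
  qed
  have eO: "e \<in> O(\<lambda>l. of_nat l powr (- (s + of_nat N + 1) - 1))"
  proof -
    have "(\<lambda>l. (Gamma (x + of_nat l) * rGamma (1 + of_nat l)) * (Gamma (y + of_nat l) * rGamma (c + of_nat (Suc N) + of_nat l)))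
        \<in> O(\<lambda>l. of_nat l powr (- (s + of_nat N + 1) - 1))"
      by (rule bigo_powr_mult, (rule asymp_equiv_imp_bigo, rule Gamma_rGamma_shift_asymp_equiv)+) (simp add: c_def)
    then show ?thesis by (simp add: e_def[abs_def] h_def mult_ac)
  qed
  obtain l0 :: nat where "- Re c < real l0" using reals_Archimedean2 by blast
  then have l0: "Re c + real l0 > 0" by linarith
  define M where "M = norm (Gamma (c + of_nat l0 + of_nat (Suc N)))
      * (\<Sum>i. norm (A (i + Suc N) * rGamma (c + of_nat l0 + of_nat (i + Suc N))))"
  have A_summable: "summable (\<lambda>i. norm (A (i + Suc N) * rGamma (c + of_nat l0 + of_nat (i + Suc N))))"
    using abs_sums_split_initial[OF A_sums[of l0], of "Suc N"] by (simp only: abs_sums_def)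
  have row_norm: "(\<Sum>i. norm (f l i)) \<le> M * norm (e l)" if l: "l \<ge> l0" for l
  proof -
    define w where "w = (\<lambda>l. c + of_nat l + of_nat (Suc N))"
    have w: "w l \<notin> \<int>\<^sub>\<le>\<^sub>0" if "l \<ge> l0" for l
      using l0 that by (intro Re_pos_notin_nonpos_Ints) (simp add: w_def)
    have rG: "rGamma (c + of_nat l + of_nat (i + Suc N)) = rGamma (w l) / pochhammer (w l) i" if "l \<ge> l0" for l i
    proof -
      have "pochhammer (w l) i \<noteq> 0" using w[OF that] pochhammer_eq_0_imp_nonpos_Int by blast
      moreover have "w l + of_nat i = c + of_nat l + of_nat (i + Suc N)" by (simp add: w_def)
      ultimately show ?thesis using pochhammer_rGamma[of "w l" i] by (simp add: field_simps)
    qed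
    have le: "norm (f l i) \<le> norm (e l) * norm (Gamma (w l0)) * norm (A (i + Suc N) * rGamma (c + of_nat l0 + of_nat (i + Suc N)))" for i
    proof -
      have nz: "pochhammer (w l0) i \<noteq> 0" using w[of l0] pochhammer_eq_0_imp_nonpos_Int by blast
      have "norm (pochhammer (w l0) i) \<le> norm (pochhammer (w l0 + of_nat (l - l0)) i)"
        by (rule norm_pochhammer_mono) (use l0 in \<open>simp add: w_def\<close>)
      moreover have "w l0 + of_nat (l - l0) = w l"
        using l by (simp add: w_def of_nat_diff)
      ultimately have "norm (pochhammer (w l0) i) \<le> norm (pochhammer (w l) i)"
        by (simp only:)
      then have "norm (1 / pochhammer (w l) i) \<le> norm (1 / pochhammer (w l0) i)"
        using nz by (simp add: norm_divide frac_le)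
      also have "1 / pochhammer (w l0) i = Gamma (w l0) * rGamma (c + of_nat l0 + of_nat (i + Suc N))"
        unfolding rG[OF order_refl] using w[of l0] by (simp add: rGamma_inverse_Gamma Gamma_eq_zero_iff)
      finally have "norm (h l * rGamma (w l)) * norm (A (i + Suc N)) * norm (1 / pochhammer (w l) i)
          \<le> norm (h l * rGamma (w l)) * norm (A (i + Suc N)) * norm (Gamma (w l0) * rGamma (c + of_nat l0 + of_nat (i + Suc N)))"
        by (intro mult_left_mono) auto
      moreover have "f l i = h l * rGamma (w l) * A (i + Suc N) * (1 / pochhammer (w l) i)"
        unfolding f_def rG[OF l] by simp
      moreover have "e l = h l * rGamma (w l)" by (simp add: e_def w_def add_ac)
      ultimately show ?thesis by (simp only: norm_mult mult_ac)
    qed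
    have "(\<Sum>i. norm (f l i)) \<le> (\<Sum>i. norm (e l) * norm (Gamma (w l0)) * norm (A (i + Suc N) * rGamma (c + of_nat l0 + of_nat (i + Suc N))))"
      using rows[of l] by (intro suminf_le le summable_mult A_summable) (simp add: abs_sums_def)
    also have "\<dots> = M * norm (e l)"
      unfolding suminf_mult[OF A_summable] M_def w_def by (simp only: mult_ac)
    finally show ?thesis .
  qed
  have norms: "summable (\<lambda>l. \<Sum>i. norm (f l i))"
  proof (rule summable_comparison_test')
    show "summable (\<lambda>l. M * norm (e l))"
      by (intro summable_mult summable_norm_powr_bigo[OF eO]) (use sN in simp)
    show "norm (\<Sum>i. norm (f l i)) \<le> M * norm (e l)" if "l \<ge> l0" for l
      using row_norm[OF that] rows[of l] by (simp add: suminf_nonneg abs_sums_def)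
  qed
  have tail: "abs_sums (\<lambda>i. A (i + Suc N) * C (i + Suc N)) (\<Sum>l. T l)"
    by (rule abs_sums_swap[OF rows norms columns])
  have T_le: "norm (T l) \<le> (\<Sum>i. norm (f l i))" for l
    using rows[of l] summable_norm[of "f l"] by (simp add: abs_sums_def sums_iff)
  have TO: "T \<in> O(\<lambda>l. of_nat l powr (- (s + of_nat N + 1) - 1))"
  proof -
    have "T \<in> O(e)"
      by (rule bigoI[of _ M], use eventually_ge_at_top[of l0] in eventually_elim)
         (use T_le row_norm order_trans in blast)
    from landau_o.big_trans[OF this eO] show ?thesis .
  qed
  have T_sums: "T sums (\<Sum>l. T l)"
    by (intro summable_sums summable_norm_cancel[OF summable_comparison_test'[OF norms]]) (use T_le in simp)
  have VO: "(\<lambda>m. (\<Sum>l<m. T l) - (\<Sum>l. T l)) \<in> O(\<lambda>m. of_nat m powr (- (s + of_nat N + 1)))"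
    by (rule limit_remainder_bigo) (use TO T_sums sN in \<open>simp_all add: sums_def\<close>)
  have sum_AC: "(\<lambda>k. A k * C k) sums ((\<Sum>l. T l) + (\<Sum>k<Suc N. A k * C k))"
    using tail sums_iff_shift[of "\<lambda>k. A k * C k" "Suc N" "\<Sum>l. T l"] unfolding abs_sums_def by blast
  have Gs: "Gamma x * Gamma y * Gamma s \<noteq> 0"
    using x y s nonpos_Ints_Int by (auto simp: Gamma_eq_zero_iff)
  have g0_summable: "summable (g0_term p a b)"
    using sums_summable[OF sum_AC] Gs unfolding C_g0 by (simp add: summable_cmult_iff)
  have g0: "g0 p a b = (\<Sum>l. T l) + (\<Sum>k<Suc N. A k * C k)"
    using sums_unique[OF sum_AC] suminf_mult[OF g0_summable, of "Gamma x * Gamma y * Gamma s"]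
    by (simp add: C_g0 g0_def x_def y_def s_def)
  define S where "S = (\<lambda>k m. \<Sum>l<m. pochhammer x l * pochhammer y l / fact l * rGamma (c + of_nat k + of_nat l))"
  define E where "E = (\<lambda>k m. \<Sum>n<Suc N - k. quotient_coeff (y + s + of_nat k) (x + s + of_nat k) n / (s + of_nat k + of_nat n)
          * (Gamma (of_nat m - (s + of_nat k) - of_nat n) * rGamma (of_nat m)))"
  \<comment> \<open>For \<open>k \<le> N\<close> the expansion with \<open>N + 1 - k\<close> terms leaves the error term of the theorem, for every \<open>k\<close> the same.\<close>
  have head: "(\<lambda>m. A k * (Gamma x * Gamma y) * (S k m - (C k / (Gamma x * Gamma y) - rGamma x * rGamma y * E k m)))
      \<in> O(\<lambda>m. of_nat m powr (- (s + of_nat N + 1)))" if k: "k < Suc N" for k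
  proof (rule bigo_cmult)
    have nonint: "s + of_nat k \<notin> \<int>"
    proof
      assume "s + of_nat k \<in> \<int>"
      then have "s + of_nat k - of_nat k \<in> \<int>" by (intro Ints_diff Ints_of_nat)
      then show False using s by simp
    qed
    have "Re (s + of_nat k) + real (Suc N - k) > 0" using sN k by (simp add: of_nat_diff)
    from gauss_partial_sum_expansion[OF x y, of "c + of_nat k" "Suc N - k", unfolded eqs, OF nonint this]
    have "(\<lambda>m. S k m - (C k / (Gamma x * Gamma y) - rGamma x * rGamma y * E k m))
        \<in> O(\<lambda>m. of_nat m powr (- (s + of_nat k) - of_nat (Suc N - k)))"
      using Gs unfolding S_def E_def C_def by simp
    moreover have "- (s + of_nat k) - of_nat (Suc N - k) = - (s + of_nat N + 1)"
      using k by (simp add: of_nat_diff)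
    ultimately show "(\<lambda>m. S k m - (C k / (Gamma x * Gamma y) - rGamma x * rGamma y * E k m))
        \<in> O(\<lambda>m. of_nat m powr (- (s + of_nat N + 1)))" by (simp only:)
  qed
  have rest: "hyp_partial_sum p a b m - (g0 p a b - expansion_sum p a b N m)
      = (\<Sum>k<Suc N. A k * (Gamma x * Gamma y) * (S k m - (C k / (Gamma x * Gamma y) - rGamma x * rGamma y * E k m)))
        + ((\<Sum>l<m. T l) - (\<Sum>l. T l))" for m
  proof -
    have "(\<Sum>l<m. u l) = (\<Sum>l<m. T l) + (\<Sum>l<m. \<Sum>k<Suc N. h l * (A k * rGamma (c + of_nat l + of_nat k)))"
      unfolding T_def sum_subtractf by simp
    also have "(\<Sum>l<m. \<Sum>k<Suc N. h l * (A k * rGamma (c + of_nat l + of_nat k)))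
        = (\<Sum>k<Suc N. \<Sum>l<m. h l * (A k * rGamma (c + of_nat l + of_nat k)))"
      by (rule sum.swap)
    also have "\<dots> = (\<Sum>k<Suc N. A k * (Gamma x * Gamma y) * S k m)"
      unfolding S_def sum_distrib_left
      by (intro sum.cong refl) (simp only: mult.left_commute[of "h _" "A _"] h_poch mult.assoc)
    finally have hyp': "hyp_partial_sum p a b m = (\<Sum>l<m. T l) + (\<Sum>k<Suc N. A k * (Gamma x * Gamma y) * S k m)"
      unfolding hyp .
    have exp': "expansion_sum p a b N m = (\<Sum>k<Suc N. A k * E k m)"
      unfolding expansion_sum_eq E_def A_def s_def x_def y_def ..
    have term_eq: "A k * (Gamma x * Gamma y) * (S k m - (C k / (Gamma x * Gamma y) - rGamma x * rGamma y * E k m))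
        = A k * (Gamma x * Gamma y) * S k m - A k * C k + A k * E k m" for k
      using Gs by (simp add: rGamma_inverse_Gamma field_simps)
    show ?thesis
      unfolding hyp' exp' g0 term_eq sum.distrib sum_subtractf by simp
  qed
  have "(\<lambda>m. hyp_partial_sum p a b m - (g0 p a b - expansion_sum p a b N m))
      \<in> O(\<lambda>m. of_nat m powr (- (s + of_nat N + 1)))"
    unfolding rest using head by (intro sum_in_bigo(1)[OF big_sum_in_bigo VO]) auto
  moreover have "- (s + of_nat N + 1) = - param_s p a b - of_nat N - 1" by (simp add: s_def)
  ultimately show ?thesis using g0_summable by (simp only: simp_thms)
qed

end
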